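(* Let $q$ be as described in the context and let $G(z)=\int_{-\infty}^{\infty} e^{-q(t)}e^{izt}\,dt$ for $z\in\mathbb{C}$. Then $G$ is an entire function all of whose zeros are real.
   Context: Let $q:\mathbb{R}\to\mathbb{R}$ be given by $q(t)=k\,t^{2m}e^{\mu t^2}\prod_n\left(1+t^2/\beta_n^2\right)$, where $k>0$, $\mu\ge 0$, $m$ is a positive integer, and $(\beta_n)$ is a finite or infinite sequence of nonzero real numbers with $\sum_n \beta_n^{-2}<\infty$ (the product is taken to be $1$ if there are no $\beta_n$). Assume moreover that there exist constants $T>0$ and $\alpha>0$ such that $q(t)>t^{2+\alpha}$ for all real $t\ge T$. *)

theory Defs
  imports "HOL-Analysis.Analysis"
begin

text \<open>The function q(t) = k t^(2m) e^(mu t^2) prod_n (1 + t^2/beta_n^2).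
  The (finite or infinite) sequence beta is given by beta :: nat => real together with
  its index set I (finite or infinite); indices outside I contribute the factor 1.\<close>
definition qfun :: "real \<Rightarrow> real \<Rightarrow> nat \<Rightarrow> (nat \<Rightarrow> real) \<Rightarrow> nat set \<Rightarrow> real \<Rightarrow> real" where
  "qfun k \<mu> m \<beta> I t =
     k * t ^ (2 * m) * exp (\<mu> * t\<^sup>2) *
     (\<Prod>n. if n \<in> I then 1 + t\<^sup>2 / (\<beta> n)\<^sup>2 else 1)"

definition Gfun :: "(real \<Rightarrow> real) \<Rightarrow> complex \<Rightarrow> complex" where
  "Gfun q z = (LINT t|lborel. complex_of_real (exp (- q t)) * exp (\<i> * z * complex_of_real t))"

end

theory Submission
  imports Defs "HOL-Complex_Analysis.Complex_Analysis"
    "HOL-Computational_Algebra.Fundamental_Theorem_Algebra"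
begin

text \<open>
  For a polynomial exponent q, integration by parts shows that the transform G satisfies
  q'(-i D) G = i z G. A root of G at maximal distance from the real axis would lose multiplicity on
  the left, by a Gauss-Lucas argument applied to the factors D - c of q'(-i D) with c real (the
  roots of q' are purely imaginary), but not on the right. To make sure that a maximal root exists,
  the argument is run for a discretised equation with a trigonometric polynomial F in place of G,
    q'(-i D) (cos (h z / 2) F) = (2 i / h) sin (h z / 2) F,
  whose coefficients satisfy a two-term recursion with finitely supported solution if h q'(J h) = 2.
  With w = exp (i h z), F becomes a polynomial p in w with roots on the unit circle, and the equation
  relates the coefficients of (1 + w) p to those of (1 - w) p.

  Since F has only real zeros, |F (x - i y)| increases with y > 0. This monotonicity survives the
  pointwise limits from F to G and from polynomial q to general q, so a nonreal zero of the limit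
  would force zeros on a whole segment.
\<close>


subsection \<open>Zeros under coefficient multipliers\<close>

lemma complex_poly_splits:
  fixes p :: "complex poly"
  assumes "p \<noteq> 0"
  obtains A where "p = smult (lead_coeff p) (\<Prod>x\<in>#A. [:- x, 1:])"
    and "size A = degree p" and "\<And>x. x \<in># A \<longleftrightarrow> poly p x = 0"
proof -
  show ?thesis
    using assms by (intro that[of "proots p"])
      (simp_all add: complex_poly_decompose_multiset size_proots_complex)
qed

lemma poly_pderiv_linear_prod:
  fixes w :: "'a :: field_char_0"
  assumes "w \<notin># A"
  shows "poly (pderiv (\<Prod>x\<in>#A. [:- x, 1:])) w =
    poly (\<Prod>x\<in>#A. [:- x, 1:]) w * (\<Sum>x\<in>#A. 1 / (w - x))"
  using assms
proof (induction A)
  case (add x A)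
  hence "w - x \<noteq> 0" by simp
  moreover have "poly (pderiv (\<Prod>x\<in>#add_mset x A. [:- x, 1:])) w =
      poly (\<Prod>x\<in>#A. [:- x, 1:]) w + (w - x) * poly (pderiv (\<Prod>x\<in>#A. [:- x, 1:])) w"
    by (simp only: image_mset_add_mset prod_mset.add_mset pderiv_mult)
       (simp add: pderiv_pCons algebra_simps)
  moreover have "poly (\<Prod>x\<in>#add_mset x A. [:- x, 1:]) w = (w - x) * poly (\<Prod>x\<in>#A. [:- x, 1:]) w"
    by (simp add: algebra_simps)
  moreover have "(\<Sum>x\<in>#add_mset x A. 1 / (w - x)) = 1 / (w - x) + (\<Sum>x\<in>#A. 1 / (w - x))"
    by simp
  moreover have "poly (pderiv (\<Prod>x\<in>#A. [:- x, 1:])) w =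
      poly (\<Prod>x\<in>#A. [:- x, 1:]) w * (\<Sum>x\<in>#A. 1 / (w - x))"
    using add by simp
  ultimately show ?case
    by (simp only: distrib_left) simp
qed simp

lemma complex_poly_logderiv:
  fixes p :: "complex poly"
  assumes "p \<noteq> 0"
  obtains A where "size A = degree p" and "\<And>x. x \<in># A \<longleftrightarrow> poly p x = 0"
    and "\<And>w. poly p w = lead_coeff p * (\<Prod>x\<in>#A. w - x)"
    and "\<And>w. poly p w \<noteq> 0 \<Longrightarrow> poly (pderiv p) w = poly p w * (\<Sum>x\<in>#A. 1 / (w - x))"
proof -
  obtain A where A: "p = smult (lead_coeff p) (\<Prod>x\<in>#A. [:- x, 1:])"
    "size A = degree p" "\<And>x. x \<in># A \<longleftrightarrow> poly p x = 0"
    using complex_poly_splits[OF assms] by blast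
  define P where "P = (\<Prod>x\<in>#A. [:- x, 1:])"
  have *: "p = smult (lead_coeff p) P" using A(1) by (simp add: P_def)
  have "poly (pderiv p) w = poly p w * (\<Sum>x\<in>#A. 1 / (w - x))" if "poly p w \<noteq> 0" for w
  proof -
    have w: "w \<notin># A" using that A(3) by blast
    have "poly (pderiv p) w = lead_coeff p * poly (pderiv P) w"
      by (subst *) (simp add: pderiv_smult)
    also have "poly (pderiv P) w = poly P w * (\<Sum>x\<in>#A. 1 / (w - x))"
      unfolding P_def by (rule poly_pderiv_linear_prod[OF w])
    also have "lead_coeff p * (poly P w * (\<Sum>x\<in>#A. 1 / (w - x))) =
       poly p w * (\<Sum>x\<in>#A. 1 / (w - x))"
      by (subst (3) *) simp
    finally show ?thesis .
  qed
  moreover have "poly p w = lead_coeff p * (\<Prod>x\<in>#A. w - x)" for w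
    by (subst A(1)) (simp add: poly_prod_mset image_mset.compositionality o_def)
  ultimately show ?thesis using A that by blast
qed

lemma Re_sum_mset: "Re (\<Sum>x\<in>#A. f x) = (\<Sum>x\<in>#A. Re (f x))"
  by (induction A) auto

lemma norm_prod_mset_ge_power:
  fixes A :: "complex multiset"
  assumes "\<And>x. x \<in># A \<Longrightarrow> norm x \<ge> R" "R \<ge> 0"
  shows "norm (\<Prod>x\<in>#A. x) \<ge> R ^ size A"
  using assms by (induction A) (auto simp: norm_mult intro!: mult_mono)

text \<open>Since \<open>w / (w - x) = 1 / (1 - x / w)\<close>, this says that
  \<open>u |-> 1 / (1 - u)\<close> maps the closed unit disc without 1 into the half plane
  \<open>Re >= 1/2\<close>, and the open disc into its interior.\<close>

lemma Re_divide_diff_ge_half: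
  fixes w x :: complex
  assumes "norm x \<le> norm w" "w \<noteq> x"
  shows "Re (w / (w - x)) \<ge> 1 / 2" and "norm x < norm w \<Longrightarrow> Re (w / (w - x)) > 1 / 2"
proof -
  have pos: "norm (w - x) ^ 2 > 0" using assms by simp
  have frac: "a / N - 1 / 2 = (2 * a - N) / (2 * N)" if "N > 0" for a N :: real
    using that by (simp add: field_simps)
  have "Re (w / (w - x)) - 1 / 2 = ((norm w)^2 - (norm x)^2) / (2 * norm (w - x) ^ 2)"
  proof -
    have "Re (w / (w - x)) = (Re w * (Re w - Re x) + Im w * (Im w - Im x)) / norm (w - x) ^ 2"
      unfolding Re_divide cmod_power2 by simp
    also have "\<dots> - 1 / 2 = (2 * (Re w * (Re w - Re x) + Im w * (Im w - Im x)) - norm (w - x) ^ 2)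
        / (2 * norm (w - x) ^ 2)"
      using frac[of "norm (w - x) ^ 2"] pos by blast
    also have "2 * (Re w * (Re w - Re x) + Im w * (Im w - Im x)) - norm (w - x) ^ 2 =
        (norm w)^2 - (norm x)^2"
      unfolding cmod_power2 by (simp add: power2_eq_square algebra_simps)
    finally show ?thesis .
  qed
  moreover have "(norm w)^2 - (norm x)^2 \<ge> 0" using assms by (simp add: power_mono)
  moreover have "(norm w)^2 - (norm x)^2 > 0" if "norm x < norm w"
    using that by (simp add: power_strict_mono)
  ultimately show "Re (w / (w - x)) \<ge> 1 / 2" "norm x < norm w \<Longrightarrow> Re (w / (w - x)) > 1 / 2"
  proof -
    assume eq: "Re (w / (w - x)) - 1 / 2 = ((norm w)^2 - (norm x)^2) / (2 * norm (w - x) ^ 2)"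
      and ge: "(norm w)^2 - (norm x)^2 \<ge> 0"
      and gt: "norm x < norm w \<Longrightarrow> (norm w)^2 - (norm x)^2 > 0"
    have "((norm w)^2 - (norm x)^2) / (2 * norm (w - x) ^ 2) \<ge> 0"
      using ge pos by (intro divide_nonneg_pos) auto
    thus "Re (w / (w - x)) \<ge> 1 / 2" using eq by linarith
    show "Re (w / (w - x)) > 1 / 2" if "norm x < norm w"
    proof -
      have "((norm w)^2 - (norm x)^2) / (2 * norm (w - x) ^ 2) > 0"
        using gt[OF that] pos by (intro divide_pos_pos) auto
      thus ?thesis using eq by linarith
    qed
  qed
qed

lemma sum_mset_gt:
  fixes f :: "'a \<Rightarrow> real"
  assumes "\<And>x. x \<in># A \<Longrightarrow> f x \<ge> c" "y \<in># A" "f y > c"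
  shows "(\<Sum>x\<in>#A. f x) > c * size A"
proof -
  obtain B where B: "A = add_mset y B" using assms(2) by (metis insert_DiffM)
  have "\<And>x. x \<in># B \<Longrightarrow> f x \<ge> c" using assms(1) B by auto
  hence "(\<Sum>x\<in>#B. f x) \<ge> c * size B"
    by (induction B) (auto simp: algebra_simps add_mono)
  thus ?thesis using assms(3) B by (simp add: algebra_simps)
qed

text \<open>The operator \<open>w d/dw - c\<close> conjugated by \<open>w^(n/2)\<close>. Under
  \<open>w = exp (i h z)\<close> it becomes, up to the factor \<open>i h\<close>, a shifted
  derivative \<open>D - i h c\<close> acting on the trigonometric polynomial
  \<open>w^(-n/2) p\<close>.\<close>

definition centred_euler :: "nat \<Rightarrow> complex \<Rightarrow> complex poly \<Rightarrow> complex poly" where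
  "centred_euler n c p = pCons 0 (pderiv p) - smult (of_nat n / 2 + c) p"

lemma coeff_centred_euler:
  "coeff (centred_euler n c p) i = (of_nat i - of_nat n / 2 - c) * coeff p i"
  by (cases i) (auto simp: centred_euler_def coeff_pderiv algebra_simps)

text \<open>Equality of the moduli of the outer coefficients is preserved by the centred Euler operator
  with purely imaginary shift, and for R > 1 it forces a root strictly inside the disc of radius R;
  this makes the estimates on the boundary circle strict.\<close>

definition root_disc :: "nat \<Rightarrow> real \<Rightarrow> complex poly \<Rightarrow> bool" where
  "root_disc n R p \<longleftrightarrow> p \<noteq> 0 \<and> degree p = n \<and> norm (coeff p 0) = norm (coeff p n) \<and>
     (\<forall>w. poly p w = 0 \<longrightarrow> norm w \<le> R)"

text \<open>Away from the roots, \<open>w p' / p\<close> is the sum of \<open>w / (w - x)\<close>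
  over the roots x. Each term has real part at least 1/2 and one has more, so the real part exceeds
  \<open>n/2\<close>, which is the real part of the number subtracted.\<close>

lemma centred_euler_nonzero:
  assumes p: "root_disc n R p" and n: "n > 0" and R: "R > 1" and c: "Re c = 0"
    and w: "norm w \<ge> R" and nz: "poly p w \<noteq> 0"
  shows "poly (centred_euler n c p) w \<noteq> 0"
proof -
  have p0: "p \<noteq> 0" and deg: "degree p = n" and eq: "norm (coeff p 0) = norm (coeff p n)"
    and rt: "\<And>w. poly p w = 0 \<Longrightarrow> norm w \<le> R"
    using p by (auto simp: root_disc_def)
  obtain A where A: "size A = degree p" "\<And>x. x \<in># A \<longleftrightarrow> poly p x = 0"
    "\<And>w. poly p w = lead_coeff p * (\<Prod>x\<in>#A. w - x)"
    "\<And>w. poly p w \<noteq> 0 \<Longrightarrow> poly (pderiv p) w = poly p w * (\<Sum>x\<in>#A. 1 / (w - x))"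
    using complex_poly_logderiv[OF p0] by blast
  \<comment> \<open>The product of the roots has modulus \<open>|p(0)| / |lead_coeff p| = 1\<close>,
    which would be at least \<open>R^n > 1\<close> if no root were strictly inside.\<close>
  have "\<exists>x\<in>#A. norm x < R"
  proof (rule ccontr)
    assume "\<not> ?thesis"
    hence "norm (\<Prod>x\<in>#image_mset uminus A. x) \<ge> R ^ size (image_mset uminus A)"
      using R by (intro norm_prod_mset_ge_power) force+
    moreover have "poly p 0 = lead_coeff p * (\<Prod>x\<in>#image_mset uminus A. x)"
      using A(3)[of 0] by simp
    hence "norm (\<Prod>x\<in>#image_mset uminus A. x) = 1"
      using eq deg p0 leading_coeff_0_iff[of p] by (auto simp: poly_0_coeff_0 norm_mult)
    moreover have "R ^ size (image_mset uminus A) > 1" using A(1) n deg R by (simp add: one_less_power)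
    ultimately show False by simp
  qed
  then obtain y where y: "y \<in># A" "norm y < R" by blast
  have wne: "w \<noteq> x" if "x \<in># A" for x using that A(2) nz by blast
  have "(\<Sum>x\<in>#A. Re (w / (w - x))) > 1 / 2 * size A"
  proof (rule sum_mset_gt[OF _ y(1)])
    show "1 / 2 \<le> Re (w / (w - x))" if "x \<in># A" for x
      using that A(2) rt w wne by (intro Re_divide_diff_ge_half) force+
    show "1 / 2 < Re (w / (w - y))"
      using y w wne by (intro Re_divide_diff_ge_half(2)) auto
  qed
  moreover have "(\<Sum>x\<in>#A. Re (w / (w - x))) = Re (w * (\<Sum>x\<in>#A. 1 / (w - x)))"
    by (simp add: Re_sum_mset sum_mset_distrib_left)
  ultimately have gt: "Re (w * (\<Sum>x\<in>#A. 1 / (w - x))) > n / 2" using A(1) deg by simp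
  have "poly (centred_euler n c p) w =
      poly p w * (w * (\<Sum>x\<in>#A. 1 / (w - x)) - (of_nat n / 2 + c))"
    by (simp add: centred_euler_def A(4)[OF nz] algebra_simps)
  moreover have "w * (\<Sum>x\<in>#A. 1 / (w - x)) - (of_nat n / 2 + c) \<noteq> 0"
  proof
    assume "w * (\<Sum>x\<in>#A. 1 / (w - x)) - (of_nat n / 2 + c) = 0"
    hence "Re (w * (\<Sum>x\<in>#A. 1 / (w - x))) = Re (of_nat n / 2 + c)" by simp
    thus False using gt c by simp
  qed
  ultimately show ?thesis using nz by simp
qed

text \<open>The outer coefficients are multiplied by \<open>-n/2 - c\<close> and
  \<open>n/2 - c\<close>; these have equal modulus because c is purely imaginary, and are nonzero
  because n is positive.\<close>

lemma root_disc_centred_euler: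
  assumes p: "root_disc n R p" and n: "n > 0" and R: "R > 1" and c: "Re c = 0"
  shows "root_disc n R (centred_euler n c p)"
proof -
  let ?q = "centred_euler n c p"
  have p0: "p \<noteq> 0" and deg: "degree p = n" and eq: "norm (coeff p 0) = norm (coeff p n)"
    and rt: "\<And>w. poly p w = 0 \<Longrightarrow> norm w \<le> R"
    using p by (auto simp: root_disc_def)
  have lc: "coeff ?q n \<noteq> 0"
  proof -
    have "of_nat n - of_nat n / 2 - c \<noteq> 0"
    proof
      assume "of_nat n - of_nat n / 2 - c = 0"
      hence "Re (of_nat n - of_nat n / 2 - c) = 0" by (simp only: zero_complex.sel)
      thus False using c n by simp
    qed
    thus ?thesis using p0 deg by (auto simp: coeff_centred_euler)
  qed
  have "degree ?q = n"
  proof (rule antisym)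
    show "degree ?q \<le> n" using deg by (intro degree_le) (auto simp: coeff_centred_euler coeff_eq_0)
    show "n \<le> degree ?q" using lc by (rule le_degree)
  qed
  moreover have "norm (- (of_nat n / 2) - c) = norm (of_nat n - of_nat n / 2 - c)"
    using c by (simp add: cmod_def)
  hence "norm (coeff ?q 0) = norm (coeff ?q n)"
    using eq by (simp add: coeff_centred_euler norm_mult)
  moreover have "norm w \<le> R" if "poly ?q w = 0" for w
  proof (rule ccontr)
    assume "\<not> norm w \<le> R"
    with centred_euler_nonzero[OF p n R c, of w] rt[of w] that show False by auto
  qed
  ultimately show ?thesis using lc by (auto simp: root_disc_def)
qed

text \<open>At a root on the circle, \<open>w p'\<close> has order exactly one less than p because w
  is nonzero, and subtracting a multiple of p cannot raise that order. At the other points of the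
  circle the image does not vanish, so the truncated subtraction is harmless.\<close>

lemma order_centred_euler:
  assumes p: "root_disc n R p" and n: "n > 0" and R: "R > 1" and c: "Re c = 0"
    and w: "norm w = R"
  shows "order w (centred_euler n c p) \<le> order w p - 1"
proof (cases "poly p w = 0")
  case False
  thus ?thesis using centred_euler_nonzero[OF p n R c _ False] w by (simp add: order_0I)
next
  case True
  let ?q = "centred_euler n c p"
  have p0: "p \<noteq> 0" using p by (auto simp: root_disc_def)
  have q0: "?q \<noteq> 0" using root_disc_centred_euler[OF p n R c] by (auto simp: root_disc_def)
  have k: "order w p = Suc (order w (pderiv p))" using order_pderiv[OF p0 True] .
  have pd: "pderiv p \<noteq> 0"
    using p n by (auto simp: root_disc_def pderiv_eq_0_iff)
  have X: "pCons 0 (pderiv p) = [:0, 1:] * pderiv p" by simp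
  have w0: "w \<noteq> 0" using w R by auto
  have ordX: "order w (pCons 0 (pderiv p)) = order w (pderiv p)"
  proof -
    have "order w [:0, 1:] = 0" using w0 by (intro order_0I) auto
    thus ?thesis unfolding X using pd by (subst order_mult) auto
  qed
  show ?thesis
  proof (rule ccontr)
    assume "\<not> ?thesis"
    hence "order w p \<le> order w ?q" using k by simp
    hence "[:- w, 1:] ^ order w p dvd ?q" by (auto simp: order_divides)
    moreover have "[:- w, 1:] ^ order w p dvd smult (of_nat n / 2 + c) p"
      by (intro dvd_smult order_1)
    ultimately have "[:- w, 1:] ^ order w p dvd ?q + smult (of_nat n / 2 + c) p" by (rule dvd_add)
    hence "[:- w, 1:] ^ order w p dvd pCons 0 (pderiv p)" by (simp add: centred_euler_def)
    hence "order w p \<le> order w (pCons 0 (pderiv p))" using pd by (auto simp: order_divides)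
    thus False using ordX k by simp
  qed
qed

text \<open>One application of \<open>centred_euler\<close> for each element of A: the coefficient
  factors multiply up to a polynomial with imaginary roots evaluated at \<open>i - n/2\<close>, and
  each application lowers the order on the circle, until it reaches 0.\<close>

lemma root_disc_multiplier:
  assumes p: "root_disc n R p" and n: "n > 0" and R: "R > 1"
    and A: "\<And>c. c \<in># A \<Longrightarrow> Re c = 0"
  shows "\<exists>r. (\<forall>i. coeff r i = poly (\<Prod>c\<in>#A. [:- c, 1:]) (of_nat i - of_nat n / 2) * coeff p i) \<and>
     root_disc n R r \<and> (\<forall>w. norm w = R \<longrightarrow> order w r \<le> order w p - size A)"
  using A
proof (induction A)
  case empty
  thus ?case using p by (intro exI[of _ p]) auto
next
  case (add c A)
  then obtain r where r: "\<And>i. coeff r i = poly (\<Prod>c\<in>#A. [:- c, 1:]) (of_nat i - of_nat n / 2) * coeff p i"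
     "root_disc n R r" "\<And>w. norm w = R \<Longrightarrow> order w r \<le> order w p - size A"
    by auto
  have c: "Re c = 0" using add by auto
  show ?case
  proof (intro exI[of _ "centred_euler n c r"] conjI allI impI)
    show "root_disc n R (centred_euler n c r)" by (rule root_disc_centred_euler[OF r(2) n R c])
    show "order w (centred_euler n c r) \<le> order w p - size (add_mset c A)" if "norm w = R" for w
      using order_centred_euler[OF r(2) n R c that] r(3)[OF that] by simp
  qed (simp add: coeff_centred_euler r(1) algebra_simps)
qed

text \<open>Let \<open>w0\<close> be a root of maximal modulus \<open>R > 1\<close>. Neither
  \<open>1 + w\<close> nor \<open>1 - w\<close> vanishes there, so \<open>(1 + w) p\<close> and
  \<open>(1 - w) p\<close> have the same positive order at \<open>w0\<close> as p. The recursion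
  obtains the second from the first by a multiplier of positive degree, which strictly lowers that
  order.\<close>

lemma roots_in_unit_disc:
  fixes p Q :: "complex poly"
  assumes p0: "p \<noteq> 0" and eq: "norm (coeff p 0) = norm (lead_coeff p)"
    and Q: "degree Q > 0" "\<And>t. poly Q t = 0 \<Longrightarrow> Re t = 0"
    and rec: "\<And>i. poly Q (of_nat i - of_nat (Suc (degree p)) / 2) * coeff ([:1, 1:] * p) i =
      coeff ([:1, -1:] * p) i"
    and w: "poly p w = 0"
  shows "norm w \<le> 1"
proof (rule ccontr)
  assume *: "\<not> norm w \<le> 1"
  define S where "S = norm ` {w. poly p w = 0}"
  have fin: "finite S" "S \<noteq> {}" unfolding S_def using poly_roots_finite[OF p0] w by auto
  define R where "R = Max S"
  have "R \<ge> norm w" unfolding R_def using fin w by (intro Max_ge) (auto simp: S_def)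
  hence R: "R > 1" using * by simp
  have "R \<in> S" unfolding R_def using fin by (rule Max_in)
  then obtain w0 where w0: "poly p w0 = 0" "norm w0 = R" by (auto simp: S_def)
  have le: "norm x \<le> R" if "poly p x = 0" for x
    unfolding R_def using fin that by (intro Max_ge) (auto simp: S_def)
  \<comment> \<open>The factor \<open>1 + w\<close> raises the degree by one, so the centre of the
    multiplier is \<open>n/2\<close> for this n; it also adds the root -1, which lies inside the
    disc.\<close>
  define n where "n = Suc (degree p)"
  define B where "B = [:1, 1:] * p"
  have B0: "B \<noteq> 0" using p0 by (simp add: B_def del: mult_pCons_left)
  have degB: "degree B = n" using p0 by (simp add: B_def n_def degree_mult_eq del: mult_pCons_left)
  have lcB: "lead_coeff B = lead_coeff p"
    unfolding B_def by (subst lead_coeff_mult) simp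
  have disc: "root_disc n R B"
    unfolding root_disc_def
  proof (intro conjI allI impI)
    show "norm (coeff B 0) = norm (coeff B n)" using eq lcB degB
      by (simp add: B_def coeff_mult del: mult_pCons_left)
    show "norm x \<le> R" if "poly B x = 0" for x
    proof -
      have "x = -1 \<or> poly p x = 0" using that by (auto simp: B_def add_eq_0_iff simp del: mult_pCons_left)
      thus ?thesis using le R by auto
    qed
  qed (use B0 degB in auto)
  have Q0: "Q \<noteq> 0" using Q(1) by auto
  obtain A where A: "Q = smult (lead_coeff Q) (\<Prod>x\<in>#A. [:- x, 1:])"
    "size A = degree Q" "\<And>x. x \<in># A \<longleftrightarrow> poly Q x = 0"
    using complex_poly_splits[OF Q0] by blast
  obtain r where r: "\<And>i. coeff r i = poly (\<Prod>c\<in>#A. [:- c, 1:]) (of_nat i - of_nat n / 2) * coeff B i"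
     "root_disc n R r" "\<And>w. norm w = R \<Longrightarrow> order w r \<le> order w B - size A"
    using root_disc_multiplier[OF disc _ R, of A] A(3) Q(2) by (auto simp: n_def)
  have "smult (lead_coeff Q) r = [:1, -1:] * p"
  proof (rule poly_eqI)
    fix i
    have "poly Q (of_nat i - of_nat n / 2) =
       lead_coeff Q * poly (\<Prod>c\<in>#A. [:- c, 1:]) (of_nat i - of_nat n / 2)"
      by (subst A(1)) simp
    thus "coeff (smult (lead_coeff Q) r) i = coeff ([:1, -1:] * p) i"
      using rec[of i] unfolding n_def[symmetric] B_def[symmetric] by (simp add: r(1) mult.assoc del: mult_pCons_left)
  qed
  hence "order w0 r = order w0 ([:1, -1:] * p)"
    using Q0 order_smult[of "lead_coeff Q" w0 r] by (simp del: mult_pCons_left)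
  also have "\<dots> = order w0 [:1, -1:] + order w0 p"
    using p0 by (intro order_mult) (auto simp del: mult_pCons_left)
  finally have ge: "order w0 r \<ge> order w0 p" by simp
  have "order w0 [:1, 1:] = 0"
  proof (rule order_0I)
    have "w0 \<noteq> -1" using w0(2) R by auto
    thus "poly [:1, 1:] w0 \<noteq> 0" by (auto simp: add_eq_0_iff)
  qed
  hence "order w0 B = order w0 p"
    unfolding B_def using p0 by (subst order_mult) (auto simp del: mult_pCons_left)
  moreover have "order w0 p > 0" using w0(1) p0 by (simp add: order_root)
  ultimately show False using ge r(3)[OF w0(2)] A(2) Q(1) by linarith
qed

text \<open>This is monotonicity of \<open>|p(r u)|^2 / r^n\<close>, proved factor by factor:
  \<open>|r u - x|^2 / r\<close> is \<open>r + |x|^2 / r\<close> plus a term independent of r, and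
  this increases for \<open>r >= 1 >= |x|\<close>. The power of r compensates for the factor
  \<open>w^(-n/2)\<close> in the trigonometric sum.\<close>

lemma norm_poly_radial_mono:
  fixes p :: "complex poly"
  assumes rt: "\<And>w. poly p w = 0 \<Longrightarrow> norm w \<le> 1" and u: "norm u = 1" and r: "1 \<le> r" "r \<le> r'"
  shows "norm (poly p (of_real r * u)) ^ 2 * r' ^ degree p \<le> norm (poly p (of_real r' * u)) ^ 2 * r ^ degree p"
proof (cases "p = 0")
  case False
  obtain A where A: "size A = degree p" "\<And>x. x \<in># A \<longleftrightarrow> poly p x = 0"
    "\<And>w. poly p w = lead_coeff p * (\<Prod>x\<in>#A. w - x)"
    using complex_poly_logderiv[OF False] by metis
  have key: "norm (of_real r * u - x) ^ 2 * r' \<le> norm (of_real r' * u - x) ^ 2 * r" if "norm x \<le> 1" for x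
  proof -
    have u2: "Re u ^ 2 + Im u ^ 2 = 1" using u by (simp add: cmod_def)
    have x2: "Re x ^ 2 + Im x ^ 2 \<le> 1" using that by (simp add: cmod_def)
    have e: "norm (of_real s * u - x) ^ 2 = s^2 + (Re x ^ 2 + Im x ^ 2) - 2 * s * (Re u * Re x + Im u * Im x)" for s
    proof -
      have "norm (of_real s * u - x) ^ 2 = s^2 * (Re u ^ 2 + Im u ^ 2) + (Re x ^ 2 + Im x ^ 2) - 2 * s * (Re u * Re x + Im u * Im x)"
        unfolding cmod_power2 by (simp add: power2_eq_square algebra_simps)
      thus ?thesis using u2 by simp
    qed
    have "norm (of_real r' * u - x) ^ 2 * r - norm (of_real r * u - x) ^ 2 * r' =
       (r' - r) * (r * r' - (Re x ^ 2 + Im x ^ 2))"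
      unfolding e by (simp add: power2_eq_square algebra_simps)
    moreover have "r * r' \<ge> 1" using r by (metis mult_mono' mult_1 order_trans zero_le_one)
    moreover have "(r' - r) * (r * r' - (Re x ^ 2 + Im x ^ 2)) \<ge> 0"
      using calculation(2) r x2 by (intro mult_nonneg_nonneg) auto
    ultimately show ?thesis by linarith
  qed
  have "norm (\<Prod>x\<in>#A. of_real r * u - x) ^ 2 * r' ^ size A \<le> norm (\<Prod>x\<in>#A. of_real r' * u - x) ^ 2 * r ^ size A"
    if "\<And>x. x \<in># A \<Longrightarrow> norm x \<le> 1" for A :: "complex multiset"
    using that
  proof (induction A)
    case (add x A)
    have "(norm (of_real r * u - x) ^ 2 * r') * (norm (\<Prod>x\<in>#A. of_real r * u - x) ^ 2 * r' ^ size A)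
      \<le> (norm (of_real r' * u - x) ^ 2 * r) * (norm (\<Prod>x\<in>#A. of_real r' * u - x) ^ 2 * r ^ size A)"
      by (intro mult_mono add.IH key add.prems mult_nonneg_nonneg zero_le_power) (use r in \<open>auto intro: add.prems\<close>)
    thus ?case by (simp add: norm_mult power_mult_distrib mult_ac)
  qed auto
  from this[of A] have "norm (\<Prod>x\<in>#A. of_real r * u - x) ^ 2 * r' ^ degree p \<le> norm (\<Prod>x\<in>#A. of_real r' * u - x) ^ 2 * r ^ degree p"
    using A(2) rt unfolding A(1) by blast
  from mult_left_mono[OF this, of "norm (lead_coeff p) ^ 2"] show ?thesis
    unfolding A(3) by (simp add: norm_mult power_mult_distrib mult_ac)
qed auto

text \<open>Gauss-Lucas for the imaginary axis: off the axis, all terms \<open>1 / (t - x)\<close>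
  of the logarithmic derivative have real part of the same sign as \<open>Re t\<close>, so their sum
  cannot vanish.\<close>

lemma pderiv_roots_imaginary:
  fixes p :: "complex poly"
  assumes rt: "\<And>t. poly p t = 0 \<Longrightarrow> Re t = 0" and t: "poly (pderiv p) t = 0" and d: "degree p > 0"
  shows "Re t = 0"
proof (rule ccontr)
  assume nz: "Re t \<noteq> 0"
  hence pt: "poly p t \<noteq> 0" using rt by blast
  have "p \<noteq> 0" using d by auto
  then obtain A where A: "size A = degree p" "\<And>x. x \<in># A \<longleftrightarrow> poly p x = 0"
    "\<And>w. poly p w \<noteq> 0 \<Longrightarrow> poly (pderiv p) w = poly p w * (\<Sum>x\<in>#A. 1 / (w - x))"
    using complex_poly_logderiv[of p] by metis
  have pos: "Re t * Re (1 / (t - x)) > 0" if "x \<in># A" for x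
  proof -
    have "Re x = 0" using that A(2) rt by blast
    hence "Re t * Re (1 / (t - x)) = (Re t)\<^sup>2 / ((Re t)\<^sup>2 + (Im t - Im x)\<^sup>2)"
      by (simp add: Re_divide power2_eq_square)
    thus ?thesis using nz by (simp add: add_pos_nonneg)
  qed
  have "A \<noteq> {#}" using A(1) d by auto
  then obtain y where y: "y \<in># A" by blast
  have "(\<Sum>x\<in>#A. Re t * Re (1 / (t - x))) > 0 * size A"
    using sum_mset_gt[of A 0 "\<lambda>x. Re t * Re (1 / (t - x))" y] pos y by force
  hence "Re t * Re (\<Sum>x\<in>#A. 1 / (t - x)) > 0"
    by (simp add: Re_sum_mset sum_mset_distrib_left)
  moreover have "(\<Sum>x\<in>#A. 1 / (t - x)) = 0" using A(3)[OF pt] t pt by simp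
  ultimately show False by simp
qed

section \<open>Monotonicity on the half line, and comparison of \<open>(1 - x) / (1 + x)\<close>
  with the exponential\<close>

lemma poly_mono_nonneg_coeffs:
  fixes p :: "real poly"
  assumes "\<And>i. coeff p i \<ge> 0" "0 \<le> x" "x \<le> y"
  shows "poly p x \<le> poly p y"
  unfolding poly_altdef using assms by (intro sum_mono mult_left_mono power_mono) auto

lemma poly_strict_mono_nonneg_coeffs:
  fixes p :: "real poly"
  assumes "\<And>i. coeff p i \<ge> 0" "degree p > 0" "0 \<le> x" "x < y"
  shows "poly p x < poly p y"
  unfolding poly_altdef
proof (rule sum_strict_mono_ex1)
  show "\<forall>i\<in>{..degree p}. coeff p i * x ^ i \<le> coeff p i * y ^ i"
    using assms by (auto intro!: mult_left_mono power_mono)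
  have "coeff p (degree p) > 0"
    using assms(1)[of "degree p"] assms(2) by (metis degree_0 leading_coeff_0_iff less_le)
  moreover have "x ^ degree p < y ^ degree p" using assms by (intro power_strict_mono) auto
  ultimately show "\<exists>i\<in>{..degree p}. coeff p i * x ^ i < coeff p i * y ^ i"
    by (intro bexI[of _ "degree p"]) auto
qed auto

text \<open>The logarithm of the quotient of the two sides vanishes at 0 and has derivative
  \<open>-2 t^2 / (1 - t^2)\<close>. The point 1, where the logarithm breaks down, is treated
  apart.\<close>

lemma ratio_le_exp:
  fixes x :: real
  assumes "0 \<le> x" "x \<le> 1"
  shows "(1 - x) / (1 + x) \<le> exp (- (2 * x))"
proof (cases "x = 1")
  case False
  hence x: "x < 1" using assms by simp
  let ?f = "\<lambda>x::real. ln (1 - x) - ln (1 + x) + 2 * x"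
  have "?f x \<le> ?f 0"
  proof (rule DERIV_nonpos_imp_nonincreasing[OF assms(1)])
    fix t assume t: "0 \<le> t" "t \<le> x"
    hence t1: "t < 1" using x by simp
    have sq: "t^2 < 1" using t t1 by (simp add: power_less_one_iff abs_square_less_1)
    have "(?f has_real_derivative (- 1 / (1 - t) - 1 / (1 + t) + 2)) (at t)"
      using t t1 by (auto intro!: derivative_eq_intros)
    moreover have "- 1 / (1 - t) - 1 / (1 + t) + 2 = - 2 * t^2 / (1 - t^2)"
    proof -
      have "1 - t \<noteq> 0" "1 + t \<noteq> 0" "1 - t^2 = (1 - t) * (1 + t)"
        using t t1 by (auto simp: power2_eq_square algebra_simps)
      thus ?thesis by (simp add: divide_simps)
    qed
    moreover have "- 2 * t^2 / (1 - t^2) \<le> 0" using sq by (simp add: divide_nonpos_pos)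
    ultimately show "\<exists>d. (?f has_real_derivative d) (at t) \<and> d \<le> 0" by metis
  qed
  hence "ln ((1 - x) / (1 + x)) \<le> - (2 * x)" using assms x by (simp add: ln_div)
  hence "exp (ln ((1 - x) / (1 + x))) \<le> exp (- (2 * x))" by simp
  thus ?thesis using assms x by simp
qed auto

lemma ratio_ge_exp:
  fixes x :: real
  assumes "0 \<le> x" "x \<le> 1 / 2"
  shows "exp (- (2 * x) - 2 * x^2) \<le> (1 - x) / (1 + x)"
proof -
  have "- (2 * x) - 2 * x^2 \<le> ln (1 - x) - ln (1 + x)"
    using ln_one_minus_pos_lower_bound[OF assms] ln_add_one_self_le_self[OF assms(1)] by simp
  hence "exp (- (2 * x) - 2 * x^2) \<le> exp (ln ((1 - x) / (1 + x)))" using assms by (simp add: ln_div)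
  thus ?thesis using assms by simp
qed

subsection \<open>Trigonometric sums\<close>

text \<open>The polynomial exponents for which the transform is discretised. Nonnegative
  coefficients make q and q' increasing on the half line, which controls the weights; evenness makes
  q' odd, so that the weights can be reflected.\<close>

locale imaginary_rooted =
  fixes q :: "real poly"
  assumes coeff_nonneg: "\<And>i. coeff q i \<ge> 0"
    and coeff_odd: "\<And>i. odd i \<Longrightarrow> coeff q i = 0"
    and coeff_0: "coeff q 0 = 0"
    and degree_pos: "degree q > 0"
    and roots: "\<And>t. poly (map_poly complex_of_real q) t = 0 \<Longrightarrow> Re t = 0"
begin

abbreviation dq :: "real poly" where "dq \<equiv> pderiv q"

lemma dq_coeff_nonneg: "coeff dq i \<ge> 0"
  by (simp add: coeff_pderiv coeff_nonneg)

lemma degree_dq_pos: "degree dq > 0"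
proof -
  have "degree q \<noteq> 1"
  proof
    assume "degree q = 1"
    hence "lead_coeff q = 0" using coeff_odd[of 1] by simp
    thus False using degree_pos by simp
  qed
  thus ?thesis using degree_pos by (simp add: degree_pderiv)
qed

lemma q_even: "poly q (- t) = poly q t"
  unfolding poly_altdef
  by (intro sum.cong refl) (metis coeff_odd mult_zero_left power_minus_even)

lemma dq_odd: "poly dq (- t) = - poly dq t"
proof -
  have "coeff dq i * (- t) ^ i = - (coeff dq i * t ^ i)" for i
    by (cases "even i") (auto simp: coeff_pderiv coeff_odd)
  thus ?thesis unfolding poly_altdef by (simp add: sum_negf)
qed

lemma dq_0: "poly dq 0 = 0"
  using dq_odd[of 0] by simp

lemma q_0: "poly q 0 = 0"
  by (simp add: poly_0_coeff_0 coeff_0)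

lemmas q_mono = poly_mono_nonneg_coeffs[of q, OF coeff_nonneg]
lemmas dq_mono = poly_mono_nonneg_coeffs[of dq, OF dq_coeff_nonneg]
lemmas dq_strict_mono = poly_strict_mono_nonneg_coeffs[of dq, OF dq_coeff_nonneg degree_dq_pos]

lemma dq_nonneg: "t \<ge> 0 \<Longrightarrow> poly dq t \<ge> 0"
  using dq_mono[of 0 t] dq_0 by simp

lemma q_nonneg: "poly q t \<ge> 0"
  using q_mono[of 0 "\<bar>t\<bar>"] q_0 q_even[of t] by (cases "t \<ge> 0") auto

lemma q_increment:
  assumes "0 \<le> a" "a < b"
  shows "(b - a) * poly dq a \<le> poly q b - poly q a" "poly q b - poly q a \<le> (b - a) * poly dq b"
proof -
  obtain c where c: "a < c" "c < b" "poly q b - poly q a = (b - a) * poly dq c"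
    using poly_MVT[OF assms(2), of q] by blast
  show "(b - a) * poly dq a \<le> poly q b - poly q a" "poly q b - poly q a \<le> (b - a) * poly dq b"
    unfolding c(3) using c assms dq_mono[of a c] dq_mono[of c b] by (auto intro!: mult_left_mono)
qed

section \<open>Choice of the mesh\<close>

lemma dq_linear_bound: "\<exists>c>0. \<forall>t\<ge>1. poly dq t \<ge> c * t"
proof (intro exI conjI allI impI)
  let ?n = "degree dq"
  show "lead_coeff dq > 0"
    using dq_coeff_nonneg[of ?n] degree_dq_pos by (metis degree_0 leading_coeff_0_iff less_le)
  fix t :: real assume t: "t \<ge> 1"
  have "lead_coeff dq * t \<le> lead_coeff dq * t ^ ?n"
    using t degree_dq_pos dq_coeff_nonneg[of ?n] by (intro mult_left_mono self_le_power) auto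
  also have "\<dots> \<le> poly dq t"
    unfolding poly_altdef using t dq_coeff_nonneg by (intro member_le_sum) auto
  finally show "lead_coeff dq * t \<le> poly dq t" .
qed

text \<open>With \<open>s = (J + 1) h\<close> the condition reads
  \<open>s q'(s) = 2 (J + 1)\<close>, which the intermediate value theorem solves. The solutions
  tend to infinity, and \<open>h q'(s) = 2\<close> together with \<open>q'(s) >= c s\<close> gives
  \<open>h <= 2 / (c s)\<close>.\<close>

lemma mesh_exists:
  "\<exists>h :: nat \<Rightarrow> real. (\<forall>J. h J > 0 \<and> h J * poly dq (real (Suc J) * h J) = 2) \<and> h \<longlonglongrightarrow> 0"
proof -
  obtain c where c: "c > 0" "\<And>t. t \<ge> 1 \<Longrightarrow> poly dq t \<ge> c * t" using dq_linear_bound by blast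
  have "\<exists>s>0. s * poly dq s = 2 * real (Suc J)" for J
  proof -
    \<comment> \<open>Upper end for the intermediate value theorem, chosen so that
      \<open>S >= 1\<close> and \<open>c S >= 2 (J + 1)\<close>.\<close>
    define S where "S = 1 + 2 * real (Suc J) / c"
    have S: "S \<ge> 1" using c by (simp add: S_def)
    have "c * S \<ge> 2 * real (Suc J)" using c by (simp add: S_def field_simps)
    also have "c * S \<le> poly dq S" using c S by simp
    also have "\<dots> \<le> S * poly dq S" using S dq_nonneg[of S] by (simp add: mult_le_cancel_right1)
    finally have ge: "2 * real (Suc J) \<le> S * poly dq S" .
    have "\<exists>s\<ge>0. s \<le> S \<and> s * poly dq s = 2 * real (Suc J)"
      using S ge by (intro IVT) (auto intro!: continuous_intros)
    thus ?thesis by (metis less_eq_real_def mult_zero_left mult_eq_0_iff of_nat_eq_0_iff old.nat.distinct(2) zero_neq_numeral)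
  qed
  then obtain s where s: "\<And>J. s J > 0" "\<And>J. s J * poly dq (s J) = 2 * real (Suc J)" by metis
  \<comment> \<open>On a bounded interval \<open>s q'(s)\<close> is bounded, whereas its value at
    \<open>s J\<close> is \<open>2 (J + 1)\<close>.\<close>
  have "filterlim s at_top sequentially"
    unfolding filterlim_at_top
  proof
    fix M :: real
    obtain N :: nat where N: "real N > max 0 M * poly dq (max 0 M)" using reals_Archimedean2 by blast
    have "s J \<ge> M" if "J \<ge> N" for J
    proof (rule ccontr)
      assume "\<not> s J \<ge> M"
      hence "s J * poly dq (s J) \<le> max 0 M * poly dq (max 0 M)"
        using s(1)[of J] by (intro mult_mono dq_mono dq_nonneg) auto
      thus False using N that s(2)[of J] by simp
    qed
    thus "\<forall>\<^sub>F J in sequentially. M \<le> s J" by (auto simp: eventually_sequentially)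
  qed
  define h where "h J = s J / real (Suc J)" for J
  have h: "h J > 0" "h J * poly dq (real (Suc J) * h J) = 2" for J
  proof -
    have "real (Suc J) * h J = s J" by (simp add: h_def)
    moreover have "s J / real (Suc J) * poly dq (s J) = 2"
      using s(2)[of J] by (simp add: field_simps)
    ultimately show "h J > 0" "h J * poly dq (real (Suc J) * h J) = 2"
      using s(1)[of J] by (simp_all add: h_def)
  qed
  have "h \<longlonglongrightarrow> 0"
  proof (rule tendsto_sandwich)
    show "\<forall>\<^sub>F J in sequentially. 0 \<le> h J" using h(1) by (auto intro!: always_eventually less_imp_le)
    have "\<forall>\<^sub>F J in sequentially. s J \<ge> 1" using \<open>filterlim s at_top sequentially\<close>
      unfolding filterlim_at_top by blast
    thus "\<forall>\<^sub>F J in sequentially. h J \<le> 2 / (c * s J)"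
    proof eventually_elim
      case (elim J)
      have "h J * (c * s J) \<le> h J * poly dq (s J)" using c(2)[OF elim] h(1)[of J] by (intro mult_left_mono) auto
      also have "\<dots> = 2" using h(2)[of J] by (simp add: h_def)
      finally show ?case using c s(1)[of J] by (simp add: field_simps)
    qed
    have "filterlim (\<lambda>J. c * s J) at_top sequentially"
      using c \<open>filterlim s at_top sequentially\<close> by (intro filterlim_tendsto_pos_mult_at_top[of _ c]) auto
    thus "(\<lambda>J. 2 / (c * s J)) \<longlonglongrightarrow> 0"
      by (intro tendsto_divide_0[OF tendsto_const] filterlim_at_top_imp_at_infinity)
  qed auto
  with h show ?thesis by blast
qed

text \<open>The weights discretise exp (- q): the recursion below is the trapezoidal rule for
  the differential equation w' = - q' w, and it stops at index J exactly when the mesh is such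
  that the node there has value 1.\<close>

definition node :: "real \<Rightarrow> nat \<Rightarrow> real" where
  "node h l = h / 2 * poly dq (real l * h)"

definition weight :: "real \<Rightarrow> nat \<Rightarrow> real" where
  "weight h j = (\<Prod>l=1..j. (1 - node h l) / (1 + node h l))"

lemma weight_0 [simp]: "weight h 0 = 1"
  by (simp add: weight_def)

lemma weight_Suc: "weight h (Suc j) = weight h j * ((1 - node h (Suc j)) / (1 + node h (Suc j)))"
  by (simp add: weight_def)

lemma node_nonneg: "h > 0 \<Longrightarrow> node h l \<ge> 0"
  by (simp add: node_def dq_nonneg)

lemma node_mono: "h > 0 \<Longrightarrow> k \<le> l \<Longrightarrow> node h k \<le> node h l"
  by (auto simp: node_def intro!: mult_left_mono dq_mono mult_right_mono)

lemma node_strict_mono: "h > 0 \<Longrightarrow> k < l \<Longrightarrow> node h k < node h l"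
  by (auto simp: node_def intro!: mult_strict_left_mono dq_strict_mono)

lemma weight_rec:
  assumes "h > 0"
  shows "node h (Suc j) * (weight h (Suc j) + weight h j) = weight h j - weight h (Suc j)"
proof -
  have "1 + node h (Suc j) \<noteq> 0" using node_nonneg[OF assms, of "Suc j"] by simp
  thus ?thesis unfolding weight_Suc by (simp add: field_simps)
qed

section \<open>Sign and size of the weights\<close>

lemma weight_pos:
  assumes h: "h > 0" and J: "node h J = 1" and j: "j < J"
  shows "weight h j > 0"
  unfolding weight_def
proof (rule prod_pos)
  fix l assume l: "l \<in> {1..j}"
  hence "node h l < 1" using node_strict_mono[OF h, of l J] J j by auto
  thus "0 < (1 - node h l) / (1 + node h l)" using node_nonneg[OF h, of l] by simp
qed

lemma weight_eq_0:
  assumes J: "node h J = 1" "J > 0" and j: "J \<le> j"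
  shows "weight h j = 0"
  unfolding weight_def using assms by (intro prod_zero) (auto intro!: bexI[of _ J])

lemma weight_nonneg:
  assumes h: "h > 0" and J: "node h J = 1" "J > 0"
  shows "weight h j \<ge> 0"
  using weight_pos[OF h J(1), of j] weight_eq_0[OF J, of j] by (cases "j < J") auto

text \<open>As q' increases, q grows over one step by at most h times q' at the right end, which is
  twice the new node; \<open>ratio_le_exp\<close> turns this into the bound for one factor. From
  index J on the weight is zero.\<close>

lemma weight_le:
  assumes h: "h > 0" and J: "node h J = 1" "J > 0"
  shows "weight h j \<le> exp (- poly q (real j * h))"
proof (cases "j < J")
  case True
  thus ?thesis
  proof (induction j)
    case (Suc j)
    have le1: "node h (Suc j) \<le> 1" using node_mono[OF h, of "Suc j" J] J Suc by auto
    have "poly q (real (Suc j) * h) - poly q (real j * h) \<le> 2 * node h (Suc j)"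
      using q_increment(2)[of "real j * h" "real (Suc j) * h"] h by (simp add: node_def algebra_simps)
    hence e: "exp (- (2 * node h (Suc j))) \<le> exp (poly q (real j * h) - poly q (real (Suc j) * h))"
      by simp
    have "weight h (Suc j) \<le> exp (- poly q (real j * h)) * exp (- (2 * node h (Suc j)))"
      unfolding weight_Suc using Suc le1 node_nonneg[OF h, of "Suc j"]
      by (intro mult_mono ratio_le_exp) auto
    also have "\<dots> \<le> exp (- poly q (real j * h)) * exp (poly q (real j * h) - poly q (real (Suc j) * h))"
      using e by (intro mult_left_mono) auto
    also have "\<dots> = exp (- poly q (real (Suc j) * h))" by (simp add: exp_add[symmetric])
    finally show ?case .
  qed (simp add: q_0)
qed (simp add: weight_eq_0[OF J])

text \<open>Now twice the node is compared with the growth of q over the following step, whence the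
  shift to \<open>Suc j\<close>. The quadratic loss in \<open>ratio_ge_exp\<close> is absorbed by
  the factor \<open>1 + node h j\<close>, which tends to 1 when the mesh shrinks near a fixed
  abscissa.\<close>

lemma weight_ge:
  assumes h: "h > 0" and j: "node h j \<le> 1 / 2"
  shows "weight h j \<ge> exp (- ((1 + node h j) * poly q (real (Suc j) * h)))"
proof -
  \<comment> \<open>The induction runs over i with the node of the final index j kept in the
    exponent, so that one factor serves all steps.\<close>
  have "weight h i \<ge> exp (- ((1 + node h j) * poly q (real (Suc i) * h)))" if "i \<le> j" for i
    using that
  proof (induction i)
    case 0
    show ?case using node_nonneg[OF h, of j] q_nonneg[of h] by (simp add: mult_nonneg_nonneg)
  next
    case (Suc i)
    let ?x = "node h (Suc i)"
    have x: "0 \<le> ?x" "?x \<le> node h j" using node_nonneg[OF h] node_mono[OF h] Suc by auto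
    have "2 * ?x \<le> poly q (real (Suc (Suc i)) * h) - poly q (real (Suc i) * h)"
      using q_increment(1)[of "real (Suc i) * h" "real (Suc (Suc i)) * h"] h
      by (simp add: node_def algebra_simps)
    hence "(1 + node h j) * (2 * ?x) \<le>
      (1 + node h j) * (poly q (real (Suc (Suc i)) * h) - poly q (real (Suc i) * h))"
      using x by (intro mult_left_mono) auto
    moreover have "?x * ?x \<le> node h j * ?x" using x by (intro mult_right_mono) auto
    ultimately have "- ((1 + node h j) * (poly q (real (Suc (Suc i)) * h) - poly q (real (Suc i) * h)))
        \<le> - (2 * ?x) - 2 * ?x^2"
      by (simp add: power2_eq_square algebra_simps)
    hence r: "exp (- ((1 + node h j) * (poly q (real (Suc (Suc i)) * h) - poly q (real (Suc i) * h))))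
        \<le> (1 - ?x) / (1 + ?x)"
      using ratio_ge_exp[of ?x] x j by (smt (verit) exp_le_cancel_iff)
    have "exp (- ((1 + node h j) * poly q (real (Suc (Suc i)) * h))) =
       exp (- ((1 + node h j) * poly q (real (Suc i) * h))) *
       exp (- ((1 + node h j) * (poly q (real (Suc (Suc i)) * h) - poly q (real (Suc i) * h))))"
      by (simp add: exp_add[symmetric] algebra_simps)
    also have "\<dots> \<le> weight h (Suc i)"
      unfolding weight_Suc using Suc r weight_def by (intro mult_mono) (auto intro: order_trans[OF exp_ge_zero])
    finally show ?case .
  qed
  thus ?thesis by simp
qed

text \<open>The integer i stands for the half-integer abscissa i + 1/2; the weights are even in it.\<close>

definition sym_weight :: "real \<Rightarrow> int \<Rightarrow> real" where
  "sym_weight h i = weight h (nat (if i \<ge> 0 then i else - 1 - i))"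

definition trig_sum :: "real \<Rightarrow> nat \<Rightarrow> complex \<Rightarrow> complex" where
  "trig_sum h J z = (\<Sum>i<2*J. of_real (sym_weight h (int i - int J)) *
     exp (\<i> * z * of_real ((real i - real J + 1 / 2) * h)))"

text \<open>For \<open>z = x - i v\<close> put \<open>w = exp (i h z) = r u\<close> with
  \<open>r = exp (h v)\<close> and \<open>|u| = 1\<close>. The sum is then
  \<open>w^(1/2 - J) p(w)\<close> with p of degree \<open>2 J - 1\<close>. The recursion for the
  weights puts the roots of p in the unit disc, and \<open>norm_poly_radial_mono\<close>
  applies.\<close>

lemma trig_sum_mono:
  assumes h: "h > 0" and J: "node h J = 1" "J > 0" and y: "0 \<le> y" "y \<le> y'"
  shows "norm (trig_sum h J (Complex x (- y))) \<le> norm (trig_sum h J (Complex x (- y')))"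
proof -
  define a where "a i = sym_weight h (int i - int J)" for i
  define p :: "complex poly" where "p = (\<Sum>i<2*J. monom (of_real (a i)) i)"
  have coeff_p: "coeff p i = of_real (a i)" for i
  proof -
    have "a i = 0" if "i \<ge> 2 * J"
      unfolding a_def sym_weight_def using that weight_eq_0[OF J] by (simp add: nat_diff_distrib)
    moreover have "coeff p i = (if i < 2 * J then of_real (a i) else 0)"
      by (simp add: p_def coeff_sum)
    ultimately show ?thesis by auto
  qed
  have a_first: "a 0 = weight h (J - 1)"
    using J(2) by (simp add: a_def sym_weight_def nat_diff_distrib)
  have a_last: "a (2 * J - 1) = weight h (J - 1)"
  proof -
    have "nat (int (2 * J - 1) - int J) = J - 1" "int (2 * J - 1) - int J \<ge> 0" using J(2) by auto
    thus ?thesis by (simp add: a_def sym_weight_def)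
  qed
  have wpos: "weight h (J - 1) > 0" using weight_pos[OF h J(1)] J(2) by simp
  have deg: "degree p = 2 * J - 1"
  proof (rule antisym)
    have "a i = 0" if "i > 2 * J - 1" for i
      unfolding a_def sym_weight_def using that weight_eq_0[OF J] by (simp add: nat_diff_distrib)
    thus "degree p \<le> 2 * J - 1" by (intro degree_le) (auto simp: coeff_p)
    show "2 * J - 1 \<le> degree p" using wpos a_last by (intro le_degree) (simp add: coeff_p)
  qed
  have p0: "p \<noteq> 0" using deg J(2) by auto
  \<comment> \<open>\<open>Q(i - J)\<close> is minus the node at the signed index
    \<open>i - J\<close>, and J is half of \<open>Suc (degree p)\<close>.\<close>
  define Q where "Q = pcompose (smult (of_real (- h / 2)) (map_poly complex_of_real dq)) [:0, of_real h:]"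
  have degQ: "degree Q > 0"
    using degree_dq_pos h by (simp add: Q_def degree_pcompose degree_map_poly)
  have poly_Q: "poly Q t = of_real (- h / 2) * poly (map_poly complex_of_real dq) (of_real h * t)" for t
    by (simp add: Q_def poly_pcompose mult.commute)
  have pd: "map_poly complex_of_real dq = pderiv (map_poly complex_of_real q)"
    by (rule poly_eqI) (simp add: coeff_map_poly coeff_pderiv)
  have rootsQ: "Re t = 0" if "poly Q t = 0" for t
  proof -
    have z: "poly (pderiv (map_poly complex_of_real q)) (of_real h * t) = 0"
      using that h by (simp add: poly_Q pd)
    have "degree (map_poly complex_of_real q) > 0" using degree_pos by (simp add: degree_map_poly)
    from pderiv_roots_imaginary[OF roots z this] have "Re (of_real h * t) = 0" .
    thus ?thesis using h by simp
  qed
  have poly_Q_real: "poly Q (of_real t) = of_real (- h / 2 * poly dq (t * h))" for t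
  proof -
    have "poly (map_poly complex_of_real dq) (of_real h * of_real t) = of_real (poly dq (t * h))"
      unfolding poly_altdef by (simp add: degree_map_poly coeff_map_poly mult.commute)
    thus ?thesis by (simp add: poly_Q)
  qed
  \<comment> \<open>The coefficients of \<open>w p\<close>, so that \<open>a + a'\<close> and
    \<open>a - a'\<close> belong to \<open>(1 + w) p\<close> and \<open>(1 - w) p\<close>.\<close>
  define a' where "a' i = (if i = 0 then 0 else a (i - 1))" for i
  \<comment> \<open>At \<open>i = 0\<close> this is the condition \<open>node h J = 1\<close>; at
    \<open>i = J\<close> the two central weights agree and \<open>q'(0) = 0\<close>. Otherwise it is
    \<open>weight_rec\<close>, read backwards for \<open>i < J\<close>; the vanishing weights make
    it valid past the upper end as well.\<close>
  have rec: "- h / 2 * poly dq ((real i - real J) * h) * (a i + a' i) = a i - a' i" for i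
  proof -
    consider "i = 0" | "0 < i" "i < J" | "i = J" | "J < i" by linarith
    thus ?thesis
    proof cases
      case 1
      have "- h / 2 * poly dq ((real i - real J) * h) = 1"
        using J(1) 1 dq_odd[of "real J * h"] by (simp add: node_def)
      thus ?thesis using 1 by (simp add: a'_def)
    next
      case 2
      define j where "j = J - 1 - i"
      have j: "real i - real J = - real (Suc j)" "a i = weight h j" "a' i = weight h (Suc j)"
        using 2 by (auto simp: a'_def j_def a_def sym_weight_def nat_diff_distrib intro!: arg_cong[of _ _ "weight h"])
      have "- h / 2 * poly dq ((real i - real J) * h) = node h (Suc j)"
        unfolding j(1) node_def using dq_odd[of "real (Suc j) * h"] by (simp add: algebra_simps)
      thus ?thesis unfolding j(2,3) using weight_rec[OF h, of j] by (simp add: add.commute)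
    next
      case 3
      have "a i = weight h 0" "a' i = weight h 0"
        using J(2) 3 by (auto simp: a'_def a_def sym_weight_def nat_diff_distrib intro!: arg_cong[of _ _ "weight h"])
      thus ?thesis using 3 dq_0 by simp
    next
      case 4
      define j where "j = i - 1 - J"
      have j: "real i - real J = real (Suc j)" "a i = weight h (Suc j)" "a' i = weight h j"
        using 4 by (auto simp: a'_def j_def a_def sym_weight_def nat_diff_distrib intro!: arg_cong[of _ _ "weight h"])
      have "- h / 2 * poly dq ((real i - real J) * h) = - node h (Suc j)"
        unfolding j(1) node_def by simp
      thus ?thesis unfolding j(2,3) using weight_rec[OF h, of j] by (simp add: algebra_simps)
    qed
  qed
  have unit: "norm w \<le> 1" if "poly p w = 0" for w
  proof (rule roots_in_unit_disc[OF p0 _ degQ rootsQ _ that])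
    show "norm (coeff p 0) = norm (lead_coeff p)"
      unfolding deg coeff_p a_first a_last ..
    fix i
    have "(of_nat i :: complex) - of_nat (Suc (degree p)) / 2 = of_real (real i - real J)"
      using J(2) by (simp add: deg of_nat_diff)
    hence "poly Q (of_nat i - of_nat (Suc (degree p)) / 2) = of_real (- h / 2 * poly dq ((real i - real J) * h))"
      by (simp only: poly_Q_real)
    moreover have "coeff ([:1, 1:] * p) i = of_real (a i + a' i)"
      by (cases i) (auto simp: a'_def coeff_p)
    moreover have "coeff ([:1, -1:] * p) i = of_real (a i - a' i)"
      by (cases i) (auto simp: a'_def coeff_p)
    ultimately show "poly Q (of_nat i - of_nat (Suc (degree p)) / 2) * coeff ([:1, 1:] * p) i = coeff ([:1, -1:] * p) i"
      using rec[of i] by (simp only: of_real_mult[symmetric])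
  qed
  \<comment> \<open>The half-integer frequencies leave the factor
    \<open>exp ((1/2 - J) h v)\<close>, whose square is cancelled exactly by the power
    \<open>2 J - 1\<close> of \<open>exp (h v)\<close>.\<close>
  have F: "norm (trig_sum h J (Complex x (- v))) ^ 2 * exp (h * v) ^ degree p =
     norm (poly p (of_real (exp (h * v)) * cis (h * x))) ^ 2" for v
  proof -
    let ?w = "of_real (exp (h * v)) * cis (h * x)" and ?z = "Complex x (- v)"
    have iz: "\<i> * ?z = Complex v x" by (simp add: complex_eq_iff)
    have w: "?w = exp (of_real h * (\<i> * ?z))"
      unfolding iz by (simp add: exp_eq_polar cis_conv_exp[symmetric])
    have "trig_sum h J ?z = (\<Sum>i<2*J. of_real (a i) * (exp (of_real ((1 / 2 - real J) * h) * (\<i> * ?z)) * ?w ^ i))"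
      unfolding trig_sum_def w exp_of_nat_mult[symmetric] exp_add[symmetric] a_def
      by (intro sum.cong refl arg_cong2[of _ _ _ _ "(*)"] arg_cong[of _ _ exp]) (simp add: algebra_simps)
    also have "\<dots> = exp (of_real ((1 / 2 - real J) * h) * (\<i> * ?z)) * poly p ?w"
      by (simp add: p_def poly_sum poly_monom sum_distrib_left mult_ac)
    finally have "norm (trig_sum h J ?z) = exp ((1 / 2 - real J) * h * v) * norm (poly p ?w)"
      unfolding iz by (simp add: norm_mult)
    hence "norm (trig_sum h J ?z) ^ 2 * exp (h * v) ^ degree p =
      (exp ((1 / 2 - real J) * h * v) ^ 2 * exp (h * v) ^ degree p) * norm (poly p ?w) ^ 2"
      by (simp add: power_mult_distrib)
    also have "exp ((1 / 2 - real J) * h * v) ^ 2 * exp (h * v) ^ degree p = exp 0"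
      unfolding exp_of_nat_mult[symmetric] exp_add[symmetric] deg using J(2)
      by (intro arg_cong[of _ _ exp]) (simp add: algebra_simps of_nat_diff)
    finally show ?thesis by simp
  qed
  let ?F = "\<lambda>v. norm (trig_sum h J (Complex x (- v)))" and ?n = "degree p"
  have "norm (poly p (of_real (exp (h * y)) * cis (h * x))) ^ 2 * exp (h * y') ^ ?n
     \<le> norm (poly p (of_real (exp (h * y')) * cis (h * x))) ^ 2 * exp (h * y) ^ ?n"
    using h y by (intro norm_poly_radial_mono unit) auto
  hence "?F y ^ 2 * (exp (h * y) ^ ?n * exp (h * y') ^ ?n) \<le> ?F y' ^ 2 * (exp (h * y) ^ ?n * exp (h * y') ^ ?n)"
    unfolding F[symmetric] by (simp add: mult_ac)
  hence "?F y ^ 2 \<le> ?F y' ^ 2" by (simp add: mult_le_cancel_right)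
  thus ?thesis by (simp add: power_mono_iff)
qed

end

subsection \<open>The integral as a function of the exponent\<close>

lemma integrable_exp_neg_abs: "integrable lborel (\<lambda>t::real. exp (- \<bar>t\<bar>))"
proof -
  let ?f = "\<lambda>t::real. indicator {0..} t *\<^sub>R exp (- t)"
  have "(\<lambda>t::real. exp (- t)) absolutely_integrable_on {0..}"
    using integrable_on_exp_minus_to_infinity[of 1 0]
    by (intro nonnegative_absolutely_integrable_1) auto
  hence f: "integrable lborel ?f"
    unfolding set_integrable_def by (subst (asm) integrable_completion) auto
  have g: "integrable lborel (\<lambda>t. ?f (0 + -1 * t))"
    by (rule lborel_integrable_real_affine[OF f]) simp
  show ?thesis
    by (rule Bochner_Integration.integrable_bound[OF Bochner_Integration.integrable_add[OF f g]])
       (auto simp: indicator_def)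
qed

text \<open>Completing the square: \<open>(B + 1) |t| - k t^2\<close> is at most
  \<open>(B + 1)^2 / (4 k)\<close>, and C is the exponential of this bound.\<close>

lemma exp_quadratic_dominated:
  fixes k B :: real
  assumes "k > 0"
  obtains C where "\<And>t::real. exp (- (k * t\<^sup>2) + B * \<bar>t\<bar>) \<le> C * exp (- \<bar>t\<bar>)"
proof
  fix t :: real
  have "k * t\<^sup>2 - (B + 1) * \<bar>t\<bar> + (B + 1)\<^sup>2 / (4 * k) = k * (\<bar>t\<bar> - (B + 1) / (2 * k))\<^sup>2"
    using assms by (simp add: power2_eq_square field_simps)
  moreover have "\<dots> \<ge> 0" using assms by simp
  ultimately have "- (k * t\<^sup>2) + B * \<bar>t\<bar> \<le> (B + 1)\<^sup>2 / (4 * k) - \<bar>t\<bar>"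
    by (simp add: algebra_simps)
  hence "exp (- (k * t\<^sup>2) + B * \<bar>t\<bar>) \<le> exp ((B + 1)\<^sup>2 / (4 * k) + - \<bar>t\<bar>)" by simp
  also have "\<dots> = exp ((B + 1)\<^sup>2 / (4 * k)) * exp (- \<bar>t\<bar>)" by (rule exp_add)
  finally show "exp (- (k * t\<^sup>2) + B * \<bar>t\<bar>) \<le> exp ((B + 1)\<^sup>2 / (4 * k)) * exp (- \<bar>t\<bar>)" .
qed

lemma norm_exp_i_mult: "norm (exp (\<i> * z * complex_of_real t)) \<le> exp (norm z * \<bar>t\<bar>)"
proof -
  have "norm (exp (\<i> * z * complex_of_real t)) \<le> exp (norm (\<i> * z * complex_of_real t))"
    by (rule norm_exp)
  thus ?thesis by (simp add: norm_mult)
qed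

text \<open>The constant depends only on k, c and B, so a single integrable majorant serves every
  exponent lying above the same parabola. This is what permits dominated convergence along a
  sequence of exponents.\<close>

lemma kernel_dominated:
  assumes "k > 0"
  obtains C where "\<And>t q. q \<ge> k * t\<^sup>2 - c \<Longrightarrow> exp (- q) * exp (B * \<bar>t\<bar>) \<le> C * exp (- \<bar>t\<bar> :: real)"
proof -
  obtain C where C: "\<And>t::real. exp (- (k * t\<^sup>2) + B * \<bar>t\<bar>) \<le> C * exp (- \<bar>t\<bar>)"
    using exp_quadratic_dominated[OF assms] by blast
  have "exp (- q) * exp (B * \<bar>t\<bar>) \<le> (exp c * C) * exp (- \<bar>t\<bar>)" if "q \<ge> k * t\<^sup>2 - c" for t q
  proof -
    have "exp (- q) * exp (B * \<bar>t\<bar>) \<le> exp (c + (- (k * t\<^sup>2) + B * \<bar>t\<bar>))"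
      unfolding exp_add[symmetric] using that by simp
    also have "\<dots> = exp c * exp (- (k * t\<^sup>2) + B * \<bar>t\<bar>)" by (rule exp_add)
    also have "\<dots> \<le> exp c * (C * exp (- \<bar>t\<bar>))" using C by (intro mult_left_mono) auto
    finally show ?thesis by (simp add: mult.assoc)
  qed
  thus ?thesis using that by blast
qed

lemma integrable_exp_growth:
  fixes q :: "real \<Rightarrow> real"
  assumes [measurable]: "q \<in> borel_measurable borel"
    and k: "k > 0" "\<And>t. q t \<ge> k * t\<^sup>2 - c"
  shows "integrable lborel (\<lambda>t. exp (- q t) * exp (B * \<bar>t\<bar>))"
proof -
  obtain C where C: "\<And>t q. q \<ge> k * t\<^sup>2 - c \<Longrightarrow> exp (- q) * exp (B * \<bar>t\<bar>) \<le> C * exp (- \<bar>t\<bar> :: real)"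
    using kernel_dominated[OF k(1)] by blast
  have "integrable lborel (\<lambda>t. C * exp (- \<bar>t\<bar>))"
    using integrable_exp_neg_abs by simp
  thus ?thesis
    by (rule Bochner_Integration.integrable_bound)
       (use C[OF k(2)] in \<open>auto intro!: AE_I2 order_trans[OF _ abs_ge_self]\<close>)
qed

lemma Gfun_integrable:
  fixes q :: "real \<Rightarrow> real"
  assumes [measurable]: "q \<in> borel_measurable borel"
    and k: "k > 0" "\<And>t. q t \<ge> k * t\<^sup>2 - c"
  shows "integrable lborel (\<lambda>t. complex_of_real (exp (- q t)) * exp (\<i> * z * complex_of_real t))"
proof (rule Bochner_Integration.integrable_bound[OF integrable_exp_growth[OF assms, of "norm z"]])
  show "AE t in lborel. norm (complex_of_real (exp (- q t)) * exp (\<i> * z * complex_of_real t))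
      \<le> norm (exp (- q t) * exp (norm z * \<bar>t\<bar>))"
    using norm_exp_i_mult by (intro AE_I2) (simp add: norm_mult)
qed simp

lemma Gfun_tendsto:
  fixes q :: "real \<Rightarrow> real" and r :: "nat \<Rightarrow> real \<Rightarrow> real"
  assumes [measurable]: "\<And>n. r n \<in> borel_measurable borel"
    and k: "k > 0" "\<And>n t. r n t \<ge> k * t\<^sup>2 - c"
    and lim: "\<And>t. (\<lambda>n. r n t) \<longlonglongrightarrow> q t"
  shows "(\<lambda>n. Gfun (r n) z) \<longlonglongrightarrow> Gfun q z"
proof -
  have [measurable]: "q \<in> borel_measurable borel"
    using lim by (rule borel_measurable_LIMSEQ_metric[rotated]) simp
  obtain C where C: "\<And>t q. q \<ge> k * t\<^sup>2 - c \<Longrightarrow> exp (- q) * exp (norm z * \<bar>t\<bar>) \<le> C * exp (- \<bar>t\<bar> :: real)"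
    using kernel_dominated[OF k(1)] by blast
  show ?thesis
    unfolding Gfun_def
  proof (rule integral_dominated_convergence[where w = "\<lambda>t. C * exp (- \<bar>t\<bar>)"])
    show "integrable lborel (\<lambda>t. C * exp (- \<bar>t\<bar>))" using integrable_exp_neg_abs by simp
    show "AE t in lborel. (\<lambda>n. complex_of_real (exp (- r n t)) * exp (\<i> * z * complex_of_real t))
        \<longlonglongrightarrow> complex_of_real (exp (- q t)) * exp (\<i> * z * complex_of_real t)"
      by (intro AE_I2 tendsto_intros lim)
    show "AE t in lborel. norm (complex_of_real (exp (- r n t)) * exp (\<i> * z * complex_of_real t))
        \<le> C * exp (- \<bar>t\<bar>)" for n
    proof (rule AE_I2)
      fix t
      have "norm (complex_of_real (exp (- r n t)) * exp (\<i> * z * complex_of_real t))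
        \<le> exp (- r n t) * exp (norm z * \<bar>t\<bar>)"
        using norm_exp_i_mult by (simp add: norm_mult)
      also have "\<dots> \<le> C * exp (- \<bar>t\<bar>)" using C k(2) .
      finally show "norm (complex_of_real (exp (- r n t)) * exp (\<i> * z * complex_of_real t))
        \<le> C * exp (- \<bar>t\<bar>)" .
    qed
  qed simp_all
qed

text \<open>Expanding \<open>exp (i z t)\<close> and integrating termwise gives a power series that
  converges at every z.\<close>

lemma Gfun_holomorphic:
  fixes q :: "real \<Rightarrow> real"
  assumes [measurable]: "q \<in> borel_measurable borel"
    and k: "k > 0" "\<And>t. q t \<ge> k * t\<^sup>2 - c"
  shows "Gfun q holomorphic_on UNIV"
proof -
  define a where "a n = (LINT t|lborel. complex_of_real (exp (- q t)) * ((\<i> * of_real t) ^ n /\<^sub>R fact n))" for n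
  have sums: "(\<lambda>n. a n * z ^ n) sums Gfun q z" for z
  proof -
    define f where "f n t = complex_of_real (exp (- q t)) * ((\<i> * z * of_real t) ^ n /\<^sub>R fact n)" for n t
    have [measurable]: "f n \<in> borel_measurable borel" for n
      unfolding f_def by measurable
    let ?E = "\<lambda>t. exp (- q t) * exp (norm z * \<bar>t\<bar>)"
    have E: "integrable lborel ?E" by (rule integrable_exp_growth[OF assms])
    have norm_f: "norm (f n t) = exp (- q t) * ((norm z * \<bar>t\<bar>) ^ n /\<^sub>R fact n)" for n t
      by (simp add: f_def norm_mult norm_power power_mult_distrib)
    \<comment> \<open>Stated for arbitrary finite sets: singletons give integrability of each term,
      initial segments give summability of the integrals of the norms.\<close>
    have partial: "(\<Sum>n\<in>A. norm (f n t)) \<le> ?E t" if "finite A" for A t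
    proof -
      have "(\<Sum>n\<in>A. (norm z * \<bar>t\<bar>) ^ n /\<^sub>R fact n) \<le> exp (norm z * \<bar>t\<bar>)"
        unfolding exp_def using that by (intro sum_le_suminf summable_exp_generic) auto
      hence "exp (- q t) * (\<Sum>n\<in>A. (norm z * \<bar>t\<bar>) ^ n /\<^sub>R fact n) \<le> ?E t"
        by (intro mult_left_mono) auto
      thus ?thesis by (simp only: norm_f sum_distrib_left)
    qed
    have int: "integrable lborel (f n)" for n
      by (rule Bochner_Integration.integrable_bound[OF E])
         (use partial[of "{n}"] in \<open>auto intro!: AE_I2 order_trans[OF _ abs_ge_self]\<close>)
    have "(\<lambda>n. integral\<^sup>L lborel (f n)) sums (LINT t|lborel. (\<Sum>n. f n t))"
    proof (rule sums_integral[OF int])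
      show "AE t in lborel. summable (\<lambda>n. norm (f n t))"
        unfolding norm_f by (intro AE_I2 summable_mult summable_exp_generic)
      show "summable (\<lambda>n. LINT t|lborel. norm (f n t))"
      proof (rule summableI_nonneg_bounded)
        fix n
        have "(\<Sum>i<n. LINT t|lborel. norm (f i t)) = (LINT t|lborel. (\<Sum>i<n. norm (f i t)))"
          using int by (intro Bochner_Integration.integral_sum[symmetric]) auto
        also have "\<dots> \<le> integral\<^sup>L lborel ?E"
          using int E partial by (intro integral_mono Bochner_Integration.integrable_sum integrable_norm) auto
        finally show "(\<Sum>i<n. LINT t|lborel. norm (f i t)) \<le> integral\<^sup>L lborel ?E" .
      qed simp
    qed
    moreover have "(\<Sum>n. f n t) = complex_of_real (exp (- q t)) * exp (\<i> * z * of_real t)" for t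
      unfolding f_def exp_def by (rule suminf_mult[OF summable_exp_generic])
    moreover have "integral\<^sup>L lborel (f n) = a n * z ^ n" for n
    proof -
      have "f n = (\<lambda>t. z ^ n * (complex_of_real (exp (- q t)) * ((\<i> * of_real t) ^ n /\<^sub>R fact n)))"
        by (auto simp: f_def power_mult_distrib)
      thus ?thesis by (simp only: a_def integral_mult_right_zero mult.commute)
    qed
    ultimately show ?thesis by (simp only: Gfun_def)
  qed
  have "Gfun q holomorphic_on ball 0 r" for r
    by (rule power_series_holomorphic[where a = a]) (use sums in simp)
  hence "Gfun q holomorphic_on (\<Union>r\<in>UNIV. ball 0 (real r))"
    by (intro holomorphic_on_UN_open) auto
  moreover have "(\<Union>r\<in>UNIV. ball (0::complex) (real r)) = UNIV"
    using reals_Archimedean2 by auto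
  ultimately show ?thesis by simp
qed

section \<open>Symmetry, non-vanishing at the origin and location of the zeros\<close>

lemma Gfun_minus:
  assumes "\<And>t. q (- t) = q t"
  shows "Gfun q (- z) = Gfun q z"
  unfolding Gfun_def
  by (subst lborel_integral_real_affine[where c = "-1" and t = 0]) (auto simp: assms)

lemma Gfun_0_nonzero:
  fixes q :: "real \<Rightarrow> real"
  assumes [measurable]: "q \<in> borel_measurable borel"
    and k: "k > 0" "\<And>t. q t \<ge> k * t\<^sup>2 - c"
  shows "Gfun q 0 \<noteq> 0"
proof
  assume "Gfun q 0 = 0"
  hence "integral\<^sup>L lborel (\<lambda>t. exp (- q t)) = 0"
    by (simp add: Gfun_def)
  moreover have "integrable lborel (\<lambda>t. exp (- q t))"
    using integrable_exp_growth[OF assms, of 0] by simp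
  ultimately have "AE t in lborel. exp (- q t) = 0"
    by (subst (asm) integral_nonneg_eq_0_iff_AE) auto
  hence "AE t::real in lborel. False" by (rule AE_mp) simp
  thus False by (subst (asm) AE_iff_null) (auto simp: null_sets_def)
qed

text \<open>This monotonicity is stable under pointwise limits and, for a nonzero entire function, forbids
  zeros in the lower half plane: such a zero would spread down the whole vertical segment to
  the real axis. This replaces Hurwitz's theorem.\<close>

definition norm_mono_below :: "(complex \<Rightarrow> complex) \<Rightarrow> bool" where
  "norm_mono_below f \<longleftrightarrow>
     (\<forall>x y y'. 0 \<le> y \<and> y \<le> y' \<longrightarrow> norm (f (Complex x (- y))) \<le> norm (f (Complex x (- y'))))"

lemma norm_mono_below_limit:
  assumes "\<And>n. norm_mono_below (f n)" and "\<And>z. (\<lambda>n. f n z) \<longlonglongrightarrow> g z"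
  shows "norm_mono_below g"
  unfolding norm_mono_below_def
proof (intro allI impI)
  fix x y y' :: real assume "0 \<le> y \<and> y \<le> y'"
  hence "norm (f n (Complex x (- y))) \<le> norm (f n (Complex x (- y')))" for n
    using assms(1) by (auto simp: norm_mono_below_def)
  thus "norm (g (Complex x (- y))) \<le> norm (g (Complex x (- y')))"
    by (intro LIMSEQ_le[OF tendsto_norm[OF assms(2)] tendsto_norm[OF assms(2)]]) auto
qed

lemma norm_mono_below_zeros:
  assumes hol: "f holomorphic_on UNIV" and mono: "norm_mono_below f"
    and nz: "f w \<noteq> 0" and z: "Im z < 0"
  shows "f z \<noteq> 0"
proof
  assume fz: "f z = 0"
  define U where "U = closed_segment (of_real (Re z)) z"
  have "f u = 0" if u: "u \<in> U" for u
  proof -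
    obtain s where s: "0 \<le> s" "s \<le> 1" "u = (1 - s) *\<^sub>R of_real (Re z) + s *\<^sub>R z"
      using u by (auto simp: U_def in_segment)
    have eq: "u = Complex (Re z) (- (s * (- Im z)))"
      unfolding s(3) by (simp add: complex_eq_iff algebra_simps)
    have "s * (- Im z) \<le> - Im z" using s z by (intro mult_left_le_one_le) auto
    moreover have "0 \<le> s * (- Im z)" using s z by (intro mult_nonneg_nonneg) auto
    ultimately have "norm (f u) \<le> norm (f (Complex (Re z) (- (- Im z))))"
      using mono unfolding eq norm_mono_below_def by blast
    thus ?thesis using fz by simp
  qed
  moreover have "z islimpt U"
  proof (rule connected_imp_perfect)
    have "of_real (Re z) \<noteq> z" using z by (auto simp: complex_eq_iff)
    hence "of_real (Re z) \<in> U \<and> z \<in> U \<and> of_real (Re z) \<noteq> z" by (auto simp: U_def)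
    thus "U \<noteq> {x}" for x by auto
  qed (auto simp: U_def)
  ultimately have "f w = 0"
    using analytic_continuation[OF hol, of U z w] by auto
  thus False using nz by simp
qed

text \<open>The lower half plane is excluded by \<open>norm_mono_below_zeros\<close>, with the
  nonzero value supplied at the origin; evenness of the transform reflects the upper half plane to
  the lower one.\<close>

lemma Gfun_zeros_real:
  fixes q :: "real \<Rightarrow> real"
  assumes q: "q \<in> borel_measurable borel" "k > 0" "\<And>t. q t \<ge> k * t\<^sup>2 - c"
    and even: "\<And>t. q (- t) = q t" and mono: "norm_mono_below (Gfun q)" and z: "Gfun q z = 0"
  shows "Im z = 0"
proof (rule ccontr)
  assume "Im z \<noteq> 0"
  then consider "Im z < 0" | "Im (- z) < 0" by fastforce
  thus False
    using norm_mono_below_zeros[OF Gfun_holomorphic[OF q] mono Gfun_0_nonzero[OF q]]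
      z Gfun_minus[of q z, OF even] by cases auto
qed

subsection \<open>Convergence of the sums to the integral\<close>

lemma floor_mult_bounds:
  fixes h t :: real
  assumes "h > 0"
  shows "of_int \<lfloor>t / h\<rfloor> * h \<le> t" "t < (of_int \<lfloor>t / h\<rfloor> + 1) * h"
proof -
  define f where "f = \<lfloor>t / h\<rfloor>"
  have "of_int f \<le> t / h" "t / h < of_int f + 1" by (auto simp: f_def)
  hence "of_int f * h \<le> t" "t < (of_int f + 1) * h" using assms by (simp_all add: field_simps)
  thus "of_int \<lfloor>t / h\<rfloor> * h \<le> t" "t < (of_int \<lfloor>t / h\<rfloor> + 1) * h" by (simp_all only: f_def)
qed

lemma floor_midpoint_approx:
  fixes h t :: real
  assumes h: "h > 0"
  shows "\<bar>(of_int \<lfloor>t / h\<rfloor> + 1 / 2) * h - t\<bar> \<le> h"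
proof -
  show ?thesis
    using floor_mult_bounds[OF h, of t] h by (auto simp: abs_le_iff algebra_simps)
qed

lemma tendsto_of_approx:
  fixes a h :: "nat \<Rightarrow> real"
  assumes "\<And>n. \<bar>a n - l\<bar> \<le> h n" "h \<longlonglongrightarrow> 0"
  shows "a \<longlonglongrightarrow> l"
  by (rule LIM_zero_cancel, rule Lim_null_comparison[OF _ assms(2)]) (use assms(1) in simp)

context imaginary_rooted
begin

lemma q_quadratic_bound: "\<exists>k>0. \<exists>c. \<forall>t. poly q t \<ge> k * t\<^sup>2 - c"
proof (intro exI conjI allI)
  let ?n = "degree q" and ?k = "lead_coeff q"
  show k: "?k > 0"
    using coeff_nonneg[of ?n] degree_pos by (metis degree_0 leading_coeff_0_iff less_le)
  have n: "?n \<ge> 2" using degree_dq_pos by (simp add: degree_pderiv)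
  fix t :: real
  show "?k * t\<^sup>2 - ?k \<le> poly q t"
  proof (cases "\<bar>t\<bar> \<ge> 1")
    case True
    have "?k * t\<^sup>2 = ?k * \<bar>t\<bar> ^ 2" by simp
    also have "\<dots> \<le> ?k * \<bar>t\<bar> ^ ?n"
      using k n True by (intro mult_left_mono power_increasing) auto
    also have "\<dots> \<le> poly q \<bar>t\<bar>"
      unfolding poly_altdef using coeff_nonneg by (intro member_le_sum) auto
    also have "\<dots> = poly q t" using q_even[of t] by (cases "t \<ge> 0") auto
    finally show ?thesis using k by simp
  next
    case False
    hence "t\<^sup>2 \<le> 1" by (simp add: abs_square_le_1)
    hence "?k * t\<^sup>2 \<le> ?k" using k by simp
    thus ?thesis using q_nonneg[of t] by linarith
  qed
qed

text \<open>The cells \<open>[f h, (f + 1) h)\<close> for f and \<open>-1 - f\<close> are mirror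
  images; folding them gives both the same index.\<close>

definition idx :: "real \<Rightarrow> real \<Rightarrow> nat" where
  "idx h t = nat (if \<lfloor>t / h\<rfloor> \<ge> 0 then \<lfloor>t / h\<rfloor> else - 1 - \<lfloor>t / h\<rfloor>)"

text \<open>The piecewise constant integrand that turns the convergence of the sums into dominated
  convergence of integrals. The exponential is sampled at the midpoint of the cell containing
  t.\<close>

definition step :: "real \<Rightarrow> complex \<Rightarrow> real \<Rightarrow> complex" where
  "step h z t = of_real (weight h (idx h t)) * exp (\<i> * z * of_real ((of_int \<lfloor>t / h\<rfloor> + 1 / 2) * h))"

lemma step_altdef:
  "step h z t = of_real (sym_weight h \<lfloor>t / h\<rfloor>) * exp (\<i> * z * of_real ((of_int \<lfloor>t / h\<rfloor> + 1 / 2) * h))"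
  by (simp add: step_def sym_weight_def idx_def)

lemma step_measurable [measurable]: "step h z \<in> borel_measurable borel"
proof -
  have "(\<lambda>t::real. \<lfloor>t / h\<rfloor>) \<in> borel \<rightarrow>\<^sub>M count_space UNIV"
    by (rule measurable_compose[OF _ measurable_real_floor]) simp
  moreover have "(\<lambda>f. of_real (sym_weight h f) * exp (\<i> * z * of_real ((of_int f + 1 / 2) * h)))
      \<in> (count_space UNIV :: int measure) \<rightarrow>\<^sub>M (borel :: complex measure)" by simp
  ultimately show ?thesis unfolding step_altdef by (rule measurable_compose)
qed

text \<open>Since the weights vanish from index J on, only the \<open>2 J\<close> cells covering
  \<open>[-J h, J h)\<close> contribute, each of length h.\<close>

lemma integral_step:
  assumes h: "h > 0" and J: "node h J = 1" "J > 0"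
  shows "integral\<^sup>L lborel (step h z) = of_real h * trig_sum h J z"
proof -
  define c where "c i = complex_of_real (sym_weight h (int i - int J)) *
     exp (\<i> * z * of_real ((real i - real J + 1 / 2) * h))" for i
  define A where "A i = {(real i - real J) * h ..< (real i - real J + 1) * h}" for i
  have A: "t \<in> A i \<longleftrightarrow> \<lfloor>t / h\<rfloor> = int i - int J" for t i
  proof -
    have "t \<in> A i \<longleftrightarrow> of_int (int i - int J) \<le> t / h \<and> t / h < of_int (int i - int J) + 1"
      using h by (simp add: A_def field_simps)
    thus ?thesis by (simp only: floor_eq_iff)
  qed
  have step: "step h z t = (\<Sum>i<2*J. indicator (A i) t *\<^sub>R c i)" for t
  proof (cases "\<lfloor>t / h\<rfloor> + int J \<in> {0..<2 * int J}")
    case True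
    define i where "i = nat (\<lfloor>t / h\<rfloor> + int J)"
    have i: "\<lfloor>t / h\<rfloor> = int i - int J" "i < 2 * J" using True by (auto simp: i_def)
    have "indicator (A j) t *\<^sub>R c j = (if j = i then c i else 0)" for j
      using i(1) by (auto simp: indicator_def A)
    hence "(\<Sum>j<2*J. indicator (A j) t *\<^sub>R c j) = c i" using i(2) by simp
    thus ?thesis unfolding step_altdef i(1) c_def by simp
  next
    case False
    define f where "f = \<lfloor>t / h\<rfloor>"
    have "idx h t \<ge> J" using False unfolding idx_def f_def[symmetric] by auto
    hence "step h z t = 0" unfolding step_def using weight_eq_0[OF J] by simp
    moreover have "indicator (A j) t *\<^sub>R c j = 0" if "j < 2 * J" for j
      using False that by (auto simp: indicator_def A)
    hence "(\<Sum>j<2*J. indicator (A j) t *\<^sub>R c j) = 0" by (intro sum.neutral) auto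
    ultimately show ?thesis by simp
  qed
  have "has_bochner_integral lborel (\<lambda>t. \<Sum>i<2*J. indicator (A i) t *\<^sub>R c i) (\<Sum>i<2*J. measure lborel (A i) *\<^sub>R c i)"
    using h by (intro has_bochner_integral_sum has_bochner_integral_indicator) (auto simp: A_def mult_right_mono)
  moreover have "measure lborel (A i) = h" for i
    using h by (simp add: A_def mult_right_mono algebra_simps)
  ultimately have "has_bochner_integral lborel (step h z) (\<Sum>i<2*J. h *\<^sub>R c i)"
    by (simp add: step[abs_def])
  thus ?thesis
    by (simp add: has_bochner_integral_integral_eq trig_sum_def c_def scaleR_conv_of_real sum_distrib_left)
qed

lemma idx_approx:
  assumes h: "h > 0"
  shows "\<bar>real (idx h t) * h - \<bar>t\<bar>\<bar> \<le> h"
proof -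
  define f where "f = \<lfloor>t / h\<rfloor>"
  note f = floor_mult_bounds[OF h, of t, folded f_def]
  have "f \<ge> 0 \<longleftrightarrow> t \<ge> 0" using h by (simp add: f_def zero_le_divide_iff)
  thus ?thesis
    using f unfolding idx_def f_def[symmetric] by (auto simp: abs_le_iff algebra_simps)
qed

text \<open>For fixed t the index times the mesh tends to \<open>|t|\<close>, so the node there
  tends to 0. Eventually \<open>weight_ge\<close> applies, and its bound and that of
  \<open>weight_le\<close> have the common limit \<open>exp (- q |t|)\<close>.\<close>

lemma step_tendsto:
  assumes h: "\<And>n. h n > 0" "h \<longlonglongrightarrow> 0" and J: "\<And>n. node (h n) (Suc n) = 1"
  shows "(\<lambda>n. step (h n) z t) \<longlonglongrightarrow> of_real (exp (- poly q t)) * exp (\<i> * z * of_real t)"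
proof -
  have idx: "(\<lambda>n. real (idx (h n) t) * h n) \<longlonglongrightarrow> \<bar>t\<bar>"
    using idx_approx[OF h(1)] h(2) by (rule tendsto_of_approx)
  have mid: "(\<lambda>n. (of_int \<lfloor>t / h n\<rfloor> + 1 / 2) * h n) \<longlonglongrightarrow> t"
    using floor_midpoint_approx[OF h(1)] h(2) by (rule tendsto_of_approx)
  have node: "(\<lambda>n. node (h n) (idx (h n) t)) \<longlonglongrightarrow> 0"
    unfolding node_def by (rule tendsto_eq_intros h(2) idx tendsto_poly | simp)+
  have "(\<lambda>n. weight (h n) (idx (h n) t)) \<longlonglongrightarrow> exp (- poly q \<bar>t\<bar>)"
  proof (rule tendsto_sandwich)
    have "\<forall>\<^sub>F n in sequentially. node (h n) (idx (h n) t) < 1 / 2"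
      using node by (rule order_tendstoD) simp
    thus "\<forall>\<^sub>F n in sequentially. exp (- ((1 + node (h n) (idx (h n) t)) * poly q (real (Suc (idx (h n) t)) * h n)))
        \<le> weight (h n) (idx (h n) t)"
      by eventually_elim (intro weight_ge h(1), simp)
    show "\<forall>\<^sub>F n in sequentially. weight (h n) (idx (h n) t) \<le> exp (- poly q (real (idx (h n) t) * h n))"
      by (intro always_eventually allI weight_le[OF h(1) J]) simp
    show "(\<lambda>n. exp (- poly q (real (idx (h n) t) * h n))) \<longlonglongrightarrow> exp (- poly q \<bar>t\<bar>)"
      by (intro tendsto_intros tendsto_poly idx)
    have "(\<lambda>n. real (idx (h n) t) * h n + h n) \<longlonglongrightarrow> \<bar>t\<bar> + 0"
      by (intro tendsto_intros idx h(2))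
    hence S: "(\<lambda>n. real (Suc (idx (h n) t)) * h n) \<longlonglongrightarrow> \<bar>t\<bar>"
      by (simp add: algebra_simps)
    have "(\<lambda>n. exp (- ((1 + node (h n) (idx (h n) t)) * poly q (real (Suc (idx (h n) t)) * h n))))
        \<longlonglongrightarrow> exp (- ((1 + 0) * poly q \<bar>t\<bar>))"
      by (intro tendsto_intros node tendsto_poly S)
    thus "(\<lambda>n. exp (- ((1 + node (h n) (idx (h n) t)) * poly q (real (Suc (idx (h n) t)) * h n))))
        \<longlonglongrightarrow> exp (- poly q \<bar>t\<bar>)" by simp
  qed
  moreover have "poly q \<bar>t\<bar> = poly q t" using q_even[of t] by (cases "t \<ge> 0") auto
  ultimately have "(\<lambda>n. weight (h n) (idx (h n) t)) \<longlonglongrightarrow> exp (- poly q t)" by simp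
  thus ?thesis unfolding step_def by (intro tendsto_intros mid)
qed

lemma step_dominated:
  "\<exists>C. \<forall>h t. 0 < h \<and> h \<le> H \<and> (\<exists>J>0. node h J = 1) \<longrightarrow> norm (step h z t) \<le> C * exp (- \<bar>t\<bar>)"
proof -
  obtain k c where k: "k > 0" "\<And>t. poly q t \<ge> k * t\<^sup>2 - c" using q_quadratic_bound by blast
  \<comment> \<open>The folded abscissa s satisfies \<open>|t| <= s + H\<close>, hence
    \<open>t^2 <= 2 s^2 + 2 H^2\<close>; this costs half of k and the additive constant
    \<open>k H^2\<close>.\<close>
  obtain C where C: "\<And>t q. q \<ge> k / 2 * t\<^sup>2 - (k * H\<^sup>2 + c) \<Longrightarrow>
      exp (- q) * exp (norm z * \<bar>t\<bar>) \<le> C * exp (- \<bar>t\<bar> :: real)"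
    using kernel_dominated[of "k / 2"] k(1) by (metis half_gt_zero)
  have "norm (step h z t) \<le> (exp (norm z * H) * C) * exp (- \<bar>t\<bar>)"
    if h: "0 < h" "h \<le> H" and J: "node h J = 1" "J > 0" for h t J
  proof -
    define s where "s = real (idx h t) * h"
    define u where "u = (of_int \<lfloor>t / h\<rfloor> + 1 / 2) * h"
    have s: "s \<ge> 0" "\<bar>t\<bar> \<le> s + H" using idx_approx[OF h(1), of t] h by (auto simp: s_def)
    have "t\<^sup>2 = \<bar>t\<bar>\<^sup>2" by simp
    also have "\<dots> \<le> (s + H)\<^sup>2" using s by (intro power_mono) auto
    also have "\<dots> \<le> 2 * s\<^sup>2 + 2 * H\<^sup>2"
      using zero_le_power2[of "s - H"] by (simp add: power2_eq_square algebra_simps)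
    finally have "k / 2 * t\<^sup>2 \<le> k / 2 * (2 * s\<^sup>2 + 2 * H\<^sup>2)" using k(1) by (intro mult_left_mono) auto
    also have "\<dots> = k * s\<^sup>2 + k * H\<^sup>2" by (simp add: algebra_simps)
    finally have q: "poly q s \<ge> k / 2 * t\<^sup>2 - (k * H\<^sup>2 + c)"
      using k(2)[of s] by simp
    have "\<bar>u\<bar> \<le> H + \<bar>t\<bar>" using floor_midpoint_approx[OF h(1), of t] h(2) by (auto simp: u_def)
    hence "norm z * \<bar>u\<bar> \<le> norm z * H + norm z * \<bar>t\<bar>"
      by (metis distrib_left mult_left_mono norm_ge_zero)
    hence e: "exp (norm z * \<bar>u\<bar>) \<le> exp (norm z * H) * exp (norm z * \<bar>t\<bar>)"
      by (simp add: exp_add[symmetric])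
    have "norm (step h z t) = weight h (idx h t) * norm (exp (\<i> * z * of_real u))"
      using weight_nonneg[OF h(1) J] by (simp add: step_def u_def norm_mult)
    also have "\<dots> \<le> exp (- poly q s) * (exp (norm z * H) * exp (norm z * \<bar>t\<bar>))"
      using weight_le[OF h(1) J, of "idx h t"] order_trans[OF norm_exp_i_mult e]
      unfolding s_def by (intro mult_mono) auto
    also have "\<dots> = exp (norm z * H) * (exp (- poly q s) * exp (norm z * \<bar>t\<bar>))" by simp
    also have "\<dots> \<le> exp (norm z * H) * (C * exp (- \<bar>t\<bar>))"
      using C[OF q] by (intro mult_left_mono) auto
    finally show ?thesis by (simp add: mult.assoc)
  qed
  thus ?thesis by blast
qed

text \<open>Each sum is monotone by \<open>trig_sum_mono\<close>; after scaling by the mesh they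
  converge to the transform, the mesh being bounded as a convergent sequence.\<close>

lemma norm_mono_below_Gfun: "norm_mono_below (Gfun (poly q))"
proof -
  obtain h :: "nat \<Rightarrow> real" where h: "\<And>n. h n > 0" "h \<longlonglongrightarrow> 0"
      and "\<And>n. h n * poly dq (real (Suc n) * h n) = 2"
    using mesh_exists by blast
  hence J: "node (h n) (Suc n) = 1" for n
    unfolding node_def by (metis div_self times_divide_eq_left zero_neq_numeral)
  obtain H where "\<And>n. norm (h n) \<le> H"
    using convergent_imp_Bseq[OF convergentI[OF h(2)]] unfolding Bseq_def by blast
  hence H: "h n \<le> H" for n by (metis abs_ge_self order_trans real_norm_def)
  show ?thesis
  proof (rule norm_mono_below_limit)
    show "norm_mono_below (\<lambda>z. of_real (h n) * trig_sum (h n) (Suc n) z)" for n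
      using h(1)[of n] trig_sum_mono[OF h(1) J]
      by (auto simp: norm_mono_below_def norm_mult intro!: mult_left_mono)
    fix z
    obtain C where C: "\<And>h t J. 0 < h \<Longrightarrow> h \<le> H \<Longrightarrow> 0 < J \<Longrightarrow> node h J = 1 \<Longrightarrow> norm (step h z t) \<le> C * exp (- \<bar>t\<bar>)"
      using step_dominated[of H z] by blast
    have "(\<lambda>n. integral\<^sup>L lborel (step (h n) z)) \<longlonglongrightarrow> Gfun (poly q) z"
      unfolding Gfun_def
    proof (rule integral_dominated_convergence[where w = "\<lambda>t. C * exp (- \<bar>t\<bar>)"])
      show "integrable lborel (\<lambda>t. C * exp (- \<bar>t\<bar>))" using integrable_exp_neg_abs by simp
      show "AE t in lborel. (\<lambda>n. step (h n) z t) \<longlonglongrightarrow> of_real (exp (- poly q t)) * exp (\<i> * z * of_real t)"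
        by (intro AE_I2 step_tendsto h J)
      show "AE t in lborel. norm (step (h n) z t) \<le> C * exp (- \<bar>t\<bar>)" for n
        using C[OF h(1) H _ J] by (intro AE_I2) simp
      show "(\<lambda>t. complex_of_real (exp (- poly q t)) * exp (\<i> * z * of_real t)) \<in> borel_measurable lborel"
        by (simp, intro borel_measurable_continuous_onI continuous_intros)
    qed simp
    thus "(\<lambda>n. of_real (h n) * trig_sum (h n) (Suc n) z) \<longlonglongrightarrow> Gfun (poly q) z"
      by (simp add: integral_step[OF h(1) J])
  qed
qed

end

subsection \<open>Polynomial approximation of the exponent\<close>

text \<open>In contrast to \<open>imaginary_rooted\<close>, no zero at the origin is demanded, so
  the class contains 1 and is closed under products; the zero comes from the monomial factor at the
  end.\<close>

definition imag_roots :: "real poly \<Rightarrow> bool" where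
  "imag_roots p \<longleftrightarrow> p \<noteq> 0 \<and> (\<forall>i. coeff p i \<ge> 0) \<and> (\<forall>i. odd i \<longrightarrow> coeff p i = 0) \<and>
     (\<forall>t. poly (map_poly complex_of_real p) t = 0 \<longrightarrow> Re t = 0)"

lemma imag_roots_mult:
  assumes "imag_roots p" "imag_roots q"
  shows "imag_roots (p * q)"
proof -
  have "map_poly complex_of_real (p * q) = map_poly complex_of_real p * map_poly complex_of_real q"
    by (rule poly_eqI) (simp add: coeff_map_poly coeff_mult)
  moreover have "coeff p j * coeff q (i - j) = 0" if "odd i" "j \<le> i" for i j
    using that assms by (cases "odd j") (auto simp: imag_roots_def)
  hence "coeff (p * q) i = 0" if "odd i" for i
    using that by (auto simp: coeff_mult intro!: sum.neutral)
  moreover have "coeff (p * q) i \<ge> 0" for i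
    using assms by (auto simp: coeff_mult imag_roots_def intro!: sum_nonneg)
  ultimately show ?thesis using assms by (auto simp: imag_roots_def)
qed

lemma imag_roots_prod: "(\<And>x. x \<in> A \<Longrightarrow> imag_roots (f x)) \<Longrightarrow> imag_roots (\<Prod>x\<in>A. f x)"
proof (induction A rule: infinite_finite_induct)
  case (insert x F)
  thus ?case by (simp add: imag_roots_mult)
qed (simp_all add: imag_roots_def map_poly_1 odd_pos)

lemma imag_roots_quadratic:
  assumes "a \<ge> 0"
  shows "imag_roots [:1, 0, a:]"
proof -
  have "Re t = 0" if t: "1 + complex_of_real a * t\<^sup>2 = 0" for t
  proof (rule ccontr)
    assume *: "Re t \<noteq> 0"
    have re: "1 + a * ((Re t)\<^sup>2 - (Im t)\<^sup>2) = 0" and im: "a * (2 * Re t * Im t) = 0"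
      using t by (auto simp: complex_eq_iff power2_eq_square)
    have "Im t = 0 \<or> a = 0" using im * by auto
    thus False
    proof
      assume "Im t = 0"
      hence "1 + a * (Re t)\<^sup>2 = 0" using re by simp
      moreover have "a * (Re t)\<^sup>2 \<ge> 0" using assms by simp
      ultimately show False by linarith
    qed (use re in simp)
  qed
  moreover have "poly (map_poly complex_of_real [:1, 0, a:]) t = 1 + of_real a * t\<^sup>2" for t
    by (simp add: map_poly_pCons power2_eq_square)
  moreover have "coeff [:1, 0, a:] i \<ge> 0" "odd i \<Longrightarrow> coeff [:1, 0, a:] i = 0" for i
    using assms by (auto simp: coeff_pCons dest: odd_pos split: nat.splits)
  ultimately show ?thesis by (auto simp: imag_roots_def)
qed

lemma imag_roots_monom:
  assumes "k > 0"
  shows "imag_roots (monom k (2 * m))"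
  using assms by (auto simp: imag_roots_def map_poly_monom poly_monom)

lemma imag_roots_imp_imaginary_rooted:
  assumes "imag_roots p" "poly p 0 = 0"
  shows "imaginary_rooted p"
proof
  show 0: "coeff p 0 = 0" using assms(2) by (simp add: poly_0_coeff_0)
  show "degree p > 0"
  proof (rule ccontr)
    assume "\<not> degree p > 0"
    hence "lead_coeff p = 0" using 0 by simp
    thus False using assms(1) by (simp add: imag_roots_def)
  qed
qed (use assms(1) in \<open>auto simp: imag_roots_def\<close>)

text \<open>The Gaussian factor is replaced by \<open>(1 + mu t^2 / (N + 1))^(N + 1)\<close>, a
  product of quadratics with imaginary roots (or constants 1), and the infinite product is
  truncated.\<close>

definition qpoly :: "real \<Rightarrow> real \<Rightarrow> nat \<Rightarrow> (nat \<Rightarrow> real) \<Rightarrow> nat set \<Rightarrow> nat \<Rightarrow> real poly" where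
  "qpoly k \<mu> m \<beta> I N = monom k (2 * m) * (\<Prod>n\<le>N. [:1, 0, \<mu> / real (Suc N):]) *
     (\<Prod>n\<le>N. [:1, 0, if n \<in> I then 1 / (\<beta> n)\<^sup>2 else 0:])"

lemma poly_qpoly:
  "poly (qpoly k \<mu> m \<beta> I N) t = k * t ^ (2 * m) * (1 + (\<mu> * t\<^sup>2) / real (Suc N)) ^ Suc N *
     (\<Prod>n\<le>N. if n \<in> I then 1 + t\<^sup>2 / (\<beta> n)\<^sup>2 else 1)"
proof -
  have "poly (\<Prod>n\<le>N. [:1, 0, \<mu> / real (Suc N):]) t = (1 + (\<mu> * t\<^sup>2) / real (Suc N)) ^ Suc N"
    by (simp add: poly_prod power2_eq_square algebra_simps del: power_Suc)
  moreover have "poly (\<Prod>n\<le>N. [:1, 0, if n \<in> I then 1 / (\<beta> n)\<^sup>2 else 0:]) t =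
     (\<Prod>n\<le>N. if n \<in> I then 1 + t\<^sup>2 / (\<beta> n)\<^sup>2 else 1)"
    unfolding poly_prod by (intro prod.cong refl) (auto simp: power2_eq_square)
  ultimately show ?thesis by (simp add: qpoly_def poly_monom del: prod_constant)
qed

lemma imaginary_rooted_qpoly:
  assumes "k > 0" "\<mu> \<ge> 0" "m > 0"
  shows "imaginary_rooted (qpoly k \<mu> m \<beta> I N)"
proof (rule imag_roots_imp_imaginary_rooted)
  show "imag_roots (qpoly k \<mu> m \<beta> I N)"
    unfolding qpoly_def using assms
    by (intro imag_roots_mult imag_roots_prod imag_roots_quadratic imag_roots_monom) auto
  show "poly (qpoly k \<mu> m \<beta> I N) 0 = 0" using assms by (simp add: poly_qpoly)
qed

text \<open>All factors other than the monomial are at least 1, so the bound is uniform in N and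
  provides the common parabola for \<open>Gfun_tendsto\<close>.\<close>

lemma qpoly_ge:
  assumes "k > 0" "\<mu> \<ge> 0" "m > 0"
  shows "poly (qpoly k \<mu> m \<beta> I N) t \<ge> k * t\<^sup>2 - k"
proof -
  have "k * t\<^sup>2 - k \<le> k * t ^ (2 * m)"
  proof (cases "t\<^sup>2 \<ge> 1")
    case True
    hence "t\<^sup>2 \<le> (t\<^sup>2) ^ m" using assms by (intro self_le_power) auto
    hence "k * t\<^sup>2 \<le> k * (t\<^sup>2) ^ m" using assms(1) by (intro mult_left_mono) auto
    hence "k * t\<^sup>2 \<le> k * t ^ (2 * m)" by (simp add: power_mult)
    thus ?thesis using assms(1) by linarith
  next
    case False
    hence "k * t\<^sup>2 \<le> k * 1" using assms by (intro mult_left_mono) auto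
    moreover have "k * t ^ (2 * m) \<ge> 0" using assms by (simp add: power_mult)
    ultimately show ?thesis by simp
  qed
  also have "\<dots> = k * t ^ (2 * m) * 1 * 1" by simp
  also have "\<dots> \<le> poly (qpoly k \<mu> m \<beta> I N) t"
    unfolding poly_qpoly using assms
    by (intro mult_mono prod_ge_1 one_le_power mult_nonneg_nonneg) (auto simp: power_mult)
  finally show ?thesis .
qed

text \<open>The factors differ from 1 by \<open>t^2\<close> times a summable sequence, so the
  product converges absolutely; the remaining factor is the classical limit for the
  exponential.\<close>

lemma qpoly_tendsto:
  assumes "summable (\<lambda>n. if n \<in> I then 1 / (\<beta> n)\<^sup>2 else 0)"
  shows "(\<lambda>N. poly (qpoly k \<mu> m \<beta> I N) t) \<longlonglongrightarrow> qfun k \<mu> m \<beta> I t"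
proof -
  let ?f = "\<lambda>n. if n \<in> I then 1 + t\<^sup>2 / (\<beta> n)\<^sup>2 else 1"
  have "summable (\<lambda>n. t\<^sup>2 * (if n \<in> I then 1 / (\<beta> n)\<^sup>2 else 0))"
    using assms by (rule summable_mult)
  moreover have "norm (?f n - 1) = t\<^sup>2 * (if n \<in> I then 1 / (\<beta> n)\<^sup>2 else 0)" for n
    by simp
  ultimately have "summable (\<lambda>n. norm (?f n - 1))" by simp
  hence "convergent_prod ?f"
    by (intro abs_convergent_prod_imp_convergent_prod) (simp only: abs_convergent_prod_conv_summable)
  hence "(\<lambda>N. \<Prod>n\<le>N. ?f n) \<longlonglongrightarrow> prodinf ?f" by (rule convergent_prod_LIMSEQ)
  moreover have "(\<lambda>N. (1 + (\<mu> * t\<^sup>2) / real (Suc N)) ^ Suc N) \<longlonglongrightarrow> exp (\<mu> * t\<^sup>2)"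
    by (rule LIMSEQ_Suc[OF tendsto_exp_limit_sequentially])
  ultimately show ?thesis
    unfolding poly_qpoly qfun_def by (intro tendsto_intros)
qed

theorem theorem1:
  fixes k \<mu> T \<alpha> :: real and m :: nat and \<beta> :: "nat \<Rightarrow> real" and I :: "nat set"
  assumes "k > 0" and "\<mu> \<ge> 0" and "m > 0"
    and "\<forall>n\<in>I. \<beta> n \<noteq> 0"
    and "summable (\<lambda>n. if n \<in> I then 1 / (\<beta> n)\<^sup>2 else 0)"
    and "T > 0" and "\<alpha> > 0"
    and "\<forall>t\<ge>T. qfun k \<mu> m \<beta> I t > t powr (2 + \<alpha>)"
  shows "(\<forall>z. integrable lborel
            (\<lambda>t. complex_of_real (exp (- qfun k \<mu> m \<beta> I t)) * exp (\<i> * z * complex_of_real t)))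
       \<and> Gfun (qfun k \<mu> m \<beta> I) holomorphic_on UNIV
       \<and> (\<forall>z. Gfun (qfun k \<mu> m \<beta> I) z = 0 \<longrightarrow> Im z = 0)"
proof -
  let ?q = "qfun k \<mu> m \<beta> I" and ?r = "\<lambda>N. poly (qpoly k \<mu> m \<beta> I N)"
  have lim: "(\<lambda>N. ?r N t) \<longlonglongrightarrow> ?q t" for t by (rule qpoly_tendsto[OF assms(5)])
  have ge: "?r N t \<ge> k * t\<^sup>2 - k" for N t by (rule qpoly_ge[OF assms(1-3)])
  have meas: "?r N \<in> borel_measurable borel" for N
    by (intro borel_measurable_continuous_onI continuous_intros)
  have q_meas: "?q \<in> borel_measurable borel"
    using lim by (rule borel_measurable_LIMSEQ_metric[OF meas])
  \<comment> \<open>The bound, being uniform in N, survives the limit and gives the decay on which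
    integrability and holomorphy rest.\<close>
  have q_ge: "?q t \<ge> k * t\<^sup>2 - k" for t
    using LIMSEQ_le_const[OF lim] ge by blast
  have even: "?q (- t) = ?q t" for t
    by (simp only: qfun_def power_mult power2_minus)
  \<comment> \<open>Second passage to the limit: from the polynomial exponents, settled by the
    discretisation, to the given one.\<close>
  have "norm_mono_below (Gfun ?q)"
    by (rule norm_mono_below_limit[OF _ Gfun_tendsto[OF meas assms(1) ge lim]])
       (rule imaginary_rooted.norm_mono_below_Gfun[OF imaginary_rooted_qpoly[OF assms(1-3)]])
  thus ?thesis
    using Gfun_integrable[OF q_meas assms(1) q_ge] Gfun_holomorphic[OF q_meas assms(1) q_ge]
      Gfun_zeros_real[OF q_meas assms(1) q_ge even] by blast
qed

end
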